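(* Let $\mathcal{M}_h$ be a triangulated closed reference surface, $\alpha\ge0$ a constant, $0=t_0<t_1<\dots<t_M=T$ a partition with $\tau_m=t_m-t_{m-1}$, and let $\Gamma_h^0$ be a closed polyhedral surface parameterized by $\vec{X}_h^0\in S(\mathcal{M}_h)^3$. Let the closed polyhedral surfaces $\Gamma_h^m$, parameterized by $\vec{X}_h^m\in S(\mathcal{M}_h)^3$, be produced by the following scheme for the volume-preserving mean curvature flow. For $m\ge1$: $\vec{u}_h^{m+1}\in S(\hat\Gamma_h^{m+1/2})^3$, $H_h^{m+1/2}\in S(\hat\Gamma_h^{m+1/2})$, $\lambda_h^{m+1}\in\mathbb{R}$ satisfy, for all $\vec{\xi}_h\in S(\hat\Gamma_h^{m+1/2})^3$ and $\eta_h\in S(\hat\Gamma_h^{m+1/2})$, $$ \left\{ \begin{aligned} &\Big(\tfrac{\vec{u}_h^{m+1}-\vec{u}_h^m}{\tau_{m+1}},\vec{\xi}_h\Big)^h_{\hat\Gamma_h^{m+1/2}} +\alpha\Big(\nabla_{\mathcal{M}_h} \vec{X}_h^{m+1/2},\nabla_{\mathcal{M}_h}\mathcal{I}_h\big((\mathbb{P}_{h}^{m+1/2}\vec{\xi}_h)\circ \hat{X}_h^{m+1/2}\big)\Big)_{\mathcal{M}_h}\\ &\qquad+\lambda_h^{m+1}\Big(H_h^{m+1/2}-\langle H_h^{m+1/2}\rangle,\mathcal{I}_h\Big[\tfrac{\vec{\xi}_h\cdot\pi_h\bar{n}_h^{m+1/2}}{|\pi_h\bar{n}_h^{m+1/2}|^2}\Big]\Big)_{\hat\Gamma_h^{m+1/2}}=0,\\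 &\Big(\nabla_{\hat\Gamma_h^{m+1/2}}\tfrac{\vec{u}_h^{m+1}+\vec{u}_h^m}{2}, \nabla_{\hat\Gamma_h^{m+1/2}}(\eta_h\vec{\nu}_h^{m+1/2})\Big)_{\hat\Gamma_h^{m+1/2}}=\Big(H_h^{m+1/2},\eta_h\Big)^h_{\hat\Gamma_h^{m+1/2}},\\ &\frac{|\Gamma_h^{m+1}|-|\Gamma_h^m|}{\tau_{m+1}}+\Big(H_h^{m+1/2}-\langle H_h^{m+1/2}\rangle,H_h^{m+1/2}-\langle H_h^{m+1/2}\rangle\Big)_{\hat\Gamma_h^{m+1/2}}=0, \end{aligned} \right. $$ where $\vec{u}_h^{m}:=\vec{X}_h^{m}\circ(\hat{X}_h^{m+1/2})^{-1}$, $\vec{X}_h^{m+1}:=\vec{u}_h^{m+1}\circ\hat{X}_h^{m+1/2}$ and $\langle H_h^{m+1/2}\rangle:=\frac{1}{|\hat\Gamma_h^{m+1/2}|}\int_{\hat\Gamma_h^{m+1/2}}H_h^{m+1/2}\,\mathrm{d}_{\Gamma_h}$. For $m=0$: $\vec{u}_h^1\in S(\Gamma_h^{1/2})^3$, $H_h^{1/2}\in S(\Gamma_h^{1/2})$, $\lambda_h^1\in\mathbb{R}$ satisfy the same system with $m=0$ in which $\hat\Gamma_h^{1/2}$ and $\hat{X}_h^{1/2}$ are replaced throughout by the unknown surface $\Gamma_h^{1/2}$ and its parameterization $\vec{X}_h^{1/2}=\frac12(\vec{X}_h^0+\vec{X}_h^1)$ (so $\vec{u}_h^{j}=\vec{X}_h^{j}\circ(\vec{X}_h^{1/2})^{-1}$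 for $j=0,1$). Let $V_h^m$ denote the volume enclosed by $\Gamma_h^m$. Then $$V_h^{m+1}=V_h^{m}=\cdots=V_h^1=V_h^0\quad\text{and}\quad |\Gamma_h^{m+1}|\le |\Gamma_h^{m}|\le \cdots\le|\Gamma_h^1|\le |\Gamma_h^0|.$$
   Context: For a closed polyhedral surface $\mathcal{N}_h=\bigcup_k T_k\subset\mathbb{R}^3$ made of (flat) triangles, $S(\mathcal{N}_h)$ is the space of continuous functions linear on each triangle and $W(\mathcal{N}_h)$ the space of functions constant on each triangle. $\mathcal{I}_h$ is the continuous piecewise linear nodal interpolation operator at the vertices. $|\mathcal N_h|$ is the area, $\nabla_{\mathcal N_h}$ the (elementwise) surface gradient, $(\cdot,\cdot)_{\mathcal{N}_h}$ the $L^2$-inner product (Frobenius product for matrix-valued functions), and the mass-lumped inner product is $(f_h,g_h)^h_{\mathcal{N}_h}=\frac13\sum_{T\in\mathcal{N}_h}|T|\sum_{j=1}^3 f_h(p_j)g_h(p_j)$, with $p_1,p_2,p_3$ the vertices of $T$ (dot product for vectors, values taken from within $T$). The projection $\pi_h:W(\mathcal{N}_h)^3\to S(\mathcal{N}_h)^3$ is defined by $(\pi_h\vec{\chi}_h,\vec{\xi}_h)^h_{\mathcal{N}_h}=(\vec{\chi}_h,\vec{\xi}_h)_{\mathcal{N}_h}$ for all $\vec{\xi}_h\in S(\mathcal{N}_h)^3$ (here $\mathcal N_h$ is $\hat\Gamma_h^{m+1/2}$ for $m\ge1$, resp. $\Gamma_h^{1/2}$ for $m=0$). The weighted unit outward normal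 of a closed polyhedral surface is the element of $S(\mathcal{N}_h)^3$ with nodal values $\pi_h\vec{n}_h(p_j)/|\pi_h\vec{n}_h(p_j)|$, where $\vec{n}_h\in W(\mathcal{N}_h)^3$ is the piecewise constant unit outward normal. All surfaces are images of the same triangulation $\mathcal{M}_h$ under continuous piecewise linear parameterizations. $\Gamma_h^m=\bigcup_kT_k^m$ is the image of $\vec X_h^m$; $\Gamma_h^{m+1/2}=\bigcup_kT_k^{m+1/2}$ is the image of $\vec{X}_h^{m+1/2}:=\frac12(\vec{X}_h^m+\vec{X}_h^{m+1})$, $m\ge0$; $\hat\Gamma_h^{m+1/2}=\bigcup_k\hat T_k^{m+1/2}$ is the image of the extrapolation $\hat{X}_h^{m+1/2}:=\vec{X}_h^m+\frac{\tau_{m+1}}{2\tau_m}(\vec{X}_h^m-\vec{X}_h^{m-1})$, $m\ge1$. For a triangle $T$ with vertices $p_1,p_2,p_3$ ordered counterclockwise when viewed from the outward normal direction, $\mathcal{J}(T)=(p_2-p_1)\times(p_3-p_1)$; put $\mathcal{J}_k^m=\mathcal{J}(T_k^m)$, $\mathcal{J}_k^{m+1/2}=\mathcal{J}(T_k^{m+1/2})$, $\hat{\mathcal{J}}_k^{m+1/2}=\mathcal{J}(\hat T_k^{m+1/2})$. The averaged-in-time normals are the piecewise constant vector fields $$\bar{n}_h^{m+1/2}\big|_{\hat T_k^{m+1/2}}=\frac{\mathcal{J}_k^m+4\mathcal{J}_k^{m+1/2}+\mathcal{J}_k^{m+1}}{6|\hat{\mathcal{J}}_k^{m+1/2}|}\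 (m\ge1),\qquad \bar{n}_h^{1/2}\big|_{T_k^{1/2}}=\frac{\mathcal{J}_k^0+4\mathcal{J}_k^{1/2}+\mathcal{J}_k^{1}}{6|\mathcal{J}_k^{1/2}|}.$$ $\vec{\nu}_h^{m+1/2}$ is the weighted unit outward normal of $\Gamma_h^{m+1/2}$, for $m\ge 1$ lifted to $\hat\Gamma_h^{m+1/2}$ (same nodal values at corresponding vertices); $\hat{\nu}_h^{m+1/2}\in S(\hat\Gamma_h^{m+1/2})^3$ is the weighted unit outward normal of $\hat\Gamma_h^{m+1/2}$. With $I$ the $3\times 3$ identity, $$\mathbb{P}_h^{m+1/2}=(\hat{\nu}_h^{m+1/2}\cdot\pi_h\bar{n}_h^{m+1/2})I-(\pi_h\bar{n}_h^{m+1/2})(\hat{\nu}_h^{m+1/2})^T\ (m\ge1),\qquad \mathbb{P}_h^{1/2}=(\vec{\nu}_h^{1/2}\cdot\pi_h\bar{n}_h^{1/2})I-(\pi_h\bar{n}_h^{1/2})(\vec{\nu}_h^{1/2})^T.$$ It is implicit that all quantities appearing in the scheme are well defined (non-degenerate triangles, nonzero nodal values of the projected normals). *)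

theory Defs
  imports "HOL-Analysis.Analysis"
begin

section \<open>Triangles and triangulated surfaces\<close>

text \<open>A triangle is given by its ordered vertices \<open>p 1\<close>, \<open>p 2\<close>, \<open>p 3\<close>. The index type \<open>3\<close> is
  the integers mod 3, so \<open>j + 1\<close> is the cyclic successor of \<open>j\<close>. A mesh is a family of triangles
  indexed by a finite type; the images of one mesh under several parameterizations
  carry the same index \<open>k\<close> for corresponding triangles.\<close>

type_synonym triangle = "3 \<Rightarrow> real^3"
type_synonym 'k mesh = "'k \<Rightarrow> triangle"

definition tri :: "triangle \<Rightarrow> (real^3) set" where
  "tri p = convex hull (range p)"

definition Jvec :: "triangle \<Rightarrow> real^3" where
  "Jvec p = cross3 (p 2 - p 1) (p 3 - p 1)"

definition tri_area :: "triangle \<Rightarrow> real" where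
  "tri_area p = norm (Jvec p) / 2"

definition surf :: "'k::finite mesh \<Rightarrow> (real^3) set" where
  "surf N = (\<Union>k. tri (N k))"

definition surf_area :: "'k::finite mesh \<Rightarrow> real" where
  "surf_area N = (\<Sum>k\<in>UNIV. tri_area (N k))"

text \<open>The clauses say: the triangles are non-degenerate; distinct triangles
  meet at most in a common vertex or a common edge; every edge lies in exactly two triangles, which
  run through it in opposite directions (coherent ordering of the vertices); the union is a
  2-manifold without boundary. Connectedness is not required.\<close>

definition closed_polyhedral_surface :: "'k::finite mesh \<Rightarrow> bool" where
  "closed_polyhedral_surface N \<longleftrightarrow>
     (\<forall>k. Jvec (N k) \<noteq> 0) \<and>
     (\<forall>k l. k \<noteq> l \<longrightarrow> range (N k) \<noteq> range (N l) \<and>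
        tri (N k) \<inter> tri (N l) = convex hull (range (N k) \<inter> range (N l))) \<and>
     (\<forall>k j. \<exists>!(l, i). N l i = N k (j + 1) \<and> N l (i + 1) = N k j) \<and>
     (\<forall>x\<in>surf N. \<exists>U. openin (top_of_set (surf N)) U \<and> x \<in> U \<and>
        U homeomorphic (UNIV :: (real^2) set))"

text \<open>\<open>unit_normal N k\<close> is the normal from whose side the vertices of triangle \<open>k\<close> are seen
  counterclockwise; \<open>outward_oriented\<close> says that it is the outward one.\<close>

definition unit_normal :: "'k mesh \<Rightarrow> 'k \<Rightarrow> real^3" where
  "unit_normal N k = sgn (Jvec (N k))"

definition outward_oriented :: "'k::finite mesh \<Rightarrow> bool" where
  "outward_oriented N \<longleftrightarrow>
     (\<forall>k. \<forall>x\<in>rel_interior (tri (N k)). \<forall>\<^sub>F e in at_right (0::real).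
        x + e *\<^sub>R unit_normal N k \<in> outside (surf N) \<and>
        x - e *\<^sub>R unit_normal N k \<in> inside (surf N))"

definition enclosed_volume :: "'k::finite mesh \<Rightarrow> real" where
  "enclosed_volume N = measure lebesgue (inside (surf N))"


section \<open>Finite element spaces, interpolation, integrals\<close>

text \<open>\<open>S_h N\<close> is the space of scalar or vector valued continuous piecewise linear functions; only the
  values on \<open>surf N\<close> matter.\<close>

definition S_h :: "'k::finite mesh \<Rightarrow> (real^3 \<Rightarrow> 'b::real_normed_vector) set" where
  "S_h N = {f. continuous_on (surf N) f \<and>
     (\<forall>k. \<exists>A b. linear A \<and> (\<forall>x\<in>tri (N k). f x = A x + b))}"

definition interp :: "'k::finite mesh \<Rightarrow> (real^3 \<Rightarrow> 'b::real_normed_vector) \<Rightarrow> real^3 \<Rightarrow> 'b" where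
  "interp N f = (SOME g. g \<in> S_h N \<and> (\<forall>k j. g (N k j) = f (N k j)))"

definition tri_integral :: "triangle \<Rightarrow> (real^3 \<Rightarrow> real) \<Rightarrow> real" where
  "tri_integral p f = norm (Jvec p) *
     integral {(s, t). 0 \<le> s \<and> 0 \<le> t \<and> s + t \<le> (1::real)}
       (\<lambda>(s, t). f (p 1 + s *\<^sub>R (p 2 - p 1) + t *\<^sub>R (p 3 - p 1)))"

text \<open>Integrands may be discontinuous across edges, so they are given elementwise: \<open>f k\<close> on
  triangle \<open>k\<close>. The inner product on \<open>real^3^3\<close> is the Frobenius product.\<close>

definition surf_integral :: "'k::finite mesh \<Rightarrow> ('k \<Rightarrow> real^3 \<Rightarrow> real) \<Rightarrow> real" where
  "surf_integral N f = (\<Sum>k\<in>UNIV. tri_integral (N k) (f k))"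

definition l2_inner ::
  "'k::finite mesh \<Rightarrow> ('k \<Rightarrow> real^3 \<Rightarrow> 'b::real_inner) \<Rightarrow> ('k \<Rightarrow> real^3 \<Rightarrow> 'b) \<Rightarrow> real" where
  "l2_inner N f g = surf_integral N (\<lambda>k x. f k x \<bullet> g k x)"

definition lumped_inner ::
  "'k::finite mesh \<Rightarrow> (real^3 \<Rightarrow> 'b::real_inner) \<Rightarrow> (real^3 \<Rightarrow> 'b) \<Rightarrow> real" where
  "lumped_inner N f g =
     1/3 * (\<Sum>k\<in>UNIV. tri_area (N k) * (\<Sum>j\<in>UNIV. f (N k j) \<bullet> g (N k j)))"

definition surf_mean :: "'k::finite mesh \<Rightarrow> (real^3 \<Rightarrow> real) \<Rightarrow> real" where
  "surf_mean N f = 1 / surf_area N * surf_integral N (\<lambda>_. f)"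

text \<open>Surface gradient of a vector field on a flat triangle: row \<open>i\<close> is the tangential
  gradient of component \<open>i\<close>, hence the condition that the matrix annihilates the normal.\<close>

definition tri_grad :: "triangle \<Rightarrow> (real^3 \<Rightarrow> real^3) \<Rightarrow> real^3 \<Rightarrow> real^3^3" where
  "tri_grad p f x =
     (THE A. (f has_derivative (\<lambda>h. A *v h)) (at x within tri p) \<and> A *v Jvec p = 0)"

definition surf_grad :: "'k mesh \<Rightarrow> (real^3 \<Rightarrow> real^3) \<Rightarrow> 'k \<Rightarrow> real^3 \<Rightarrow> real^3^3" where
  "surf_grad N f k = tri_grad (N k) f"

text \<open>Piecewise constant fields are functions of the triangle index.\<close>

definition pi_h :: "'k::finite mesh \<Rightarrow> ('k \<Rightarrow> real^3) \<Rightarrow> real^3 \<Rightarrow> real^3" where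
  "pi_h N w = (SOME v. v \<in> S_h N \<and>
     (\<forall>\<xi>\<in>S_h N. lumped_inner N v \<xi> = l2_inner N (\<lambda>k _. w k) (\<lambda>_. \<xi>)))"

definition weighted_normal :: "'k::finite mesh \<Rightarrow> real^3 \<Rightarrow> real^3" where
  "weighted_normal N = interp N (\<lambda>x. sgn (pi_h N (unit_normal N) x))"


section \<open>Parameterized surfaces\<close>

definition image_mesh :: "(real^3 \<Rightarrow> real^3) \<Rightarrow> 'k mesh \<Rightarrow> 'k mesh" where
  "image_mesh X M = (\<lambda>k j. X (M k j))"

definition parameterizes :: "'k::finite mesh \<Rightarrow> (real^3 \<Rightarrow> real^3) \<Rightarrow> bool" where
  "parameterizes M X \<longleftrightarrow> X \<in> S_h M \<and> inj_on X (surf M) \<and>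
     closed_polyhedral_surface (image_mesh X M) \<and> outward_oriented (image_mesh X M)"

text \<open>\<open>lift M Y F\<close> is \<open>F \<circ> Y\<inverse>\<close>, a function on the surface parameterized by \<open>Y\<close>.\<close>

definition lift ::
  "'k::finite mesh \<Rightarrow> (real^3 \<Rightarrow> real^3) \<Rightarrow> (real^3 \<Rightarrow> 'b) \<Rightarrow> real^3 \<Rightarrow> 'b" where
  "lift M Y F = F \<circ> inv_into (surf M) Y"

definition mid_param :: "(real^3 \<Rightarrow> real^3) \<Rightarrow> (real^3 \<Rightarrow> real^3) \<Rightarrow> real^3 \<Rightarrow> real^3" where
  "mid_param X0 X1 = (\<lambda>x. (1/2) *\<^sub>R (X0 x + X1 x))"


section \<open>The scheme\<close>

definition step_size :: "(nat \<Rightarrow> real) \<Rightarrow> nat \<Rightarrow> real" where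
  "step_size t m = t m - t (m - 1)"

definition extrap_param ::
  "(nat \<Rightarrow> real) \<Rightarrow> (nat \<Rightarrow> real^3 \<Rightarrow> real^3) \<Rightarrow> nat \<Rightarrow> real^3 \<Rightarrow> real^3" where
  "extrap_param t X m =
     (\<lambda>x. X m x + (step_size t (m + 1) / (2 * step_size t m)) *\<^sub>R (X m x - X (m - 1) x))"

text \<open>Parameterization of the surface on which step \<open>m\<close> is posed: the extrapolated surface for
  \<open>m \<ge> 1\<close>, the unknown midpoint surface for \<open>m = 0\<close>.\<close>

definition base_param ::
  "(nat \<Rightarrow> real) \<Rightarrow> (nat \<Rightarrow> real^3 \<Rightarrow> real^3) \<Rightarrow> nat \<Rightarrow> real^3 \<Rightarrow> real^3" where
  "base_param t X m = (if m = 0 then mid_param (X 0) (X 1) else extrap_param t X m)"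

text \<open>Below, \<open>Y\<close> is the base parameterization of a step, \<open>X0\<close> and \<open>X1\<close> are the old and the new
  parameterization.\<close>

definition averaged_normal ::
  "'k::finite mesh \<Rightarrow> (real^3 \<Rightarrow> real^3) \<Rightarrow> (real^3 \<Rightarrow> real^3) \<Rightarrow> (real^3 \<Rightarrow> real^3) \<Rightarrow> 'k \<Rightarrow> real^3"
  where
  "averaged_normal M Y X0 X1 k =
     (1 / (6 * norm (Jvec (image_mesh Y M k)))) *\<^sub>R
       (Jvec (image_mesh X0 M k) + 4 *\<^sub>R Jvec (image_mesh (mid_param X0 X1) M k)
        + Jvec (image_mesh X1 M k))"

definition Pmat :: "real^3 \<Rightarrow> real^3 \<Rightarrow> real^3^3" where
  "Pmat \<nu> q = (\<nu> \<bullet> q) *\<^sub>R mat 1 - (\<chi> i j. q $ i * \<nu> $ j)"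

definition step_well_defined ::
  "'k::finite mesh \<Rightarrow> (real^3 \<Rightarrow> real^3) \<Rightarrow> (real^3 \<Rightarrow> real^3) \<Rightarrow> (real^3 \<Rightarrow> real^3) \<Rightarrow> bool" where
  "step_well_defined M Y X0 X1 \<longleftrightarrow>
     (let G = image_mesh Y M; Gmid = image_mesh (mid_param X0 X1) M in
       \<forall>k j. pi_h G (unit_normal G) (G k j) \<noteq> 0 \<and>
             pi_h Gmid (unit_normal Gmid) (Gmid k j) \<noteq> 0 \<and>
             pi_h G (averaged_normal M Y X0 X1) (G k j) \<noteq> 0)"

text \<open>One step of the scheme with step size \<open>\<tau>\<close> and unknowns \<open>u1\<close>, \<open>H\<close>, \<open>lam\<close>. For \<open>Y\<close> the
  midpoint parameterization (first step) \<open>\<nu>\<close> and \<open>\<nu>hat\<close> agree on the surface.\<close>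

definition scheme_step ::
  "'k::finite mesh \<Rightarrow> real \<Rightarrow> real \<Rightarrow> (real^3 \<Rightarrow> real^3) \<Rightarrow> (real^3 \<Rightarrow> real^3) \<Rightarrow> (real^3 \<Rightarrow> real^3)
    \<Rightarrow> (real^3 \<Rightarrow> real^3) \<Rightarrow> (real^3 \<Rightarrow> real) \<Rightarrow> real \<Rightarrow> bool" where
  "scheme_step M \<alpha> \<tau> Y X0 X1 u1 H lam \<longleftrightarrow>
     (let G = image_mesh Y M;
          Xmid = mid_param X0 X1;
          u0 = lift M Y X0;
          q = pi_h G (averaged_normal M Y X0 X1);
          \<nu>hat = weighted_normal G;
          \<nu> = lift M Y (weighted_normal (image_mesh Xmid M) \<circ> Xmid);
          H0 = (\<lambda>x. H x - surf_mean G H)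
      in u1 \<in> S_h G \<and> H \<in> S_h G \<and> (\<forall>x\<in>surf M. X1 x = u1 (Y x)) \<and>
         (\<forall>\<xi>\<in>S_h G.
            lumped_inner G (\<lambda>x. (1/\<tau>) *\<^sub>R (u1 x - u0 x)) \<xi>
            + \<alpha> * l2_inner M (surf_grad M Xmid)
                    (surf_grad M (interp M ((\<lambda>x. Pmat (\<nu>hat x) (q x) *v \<xi> x) \<circ> Y)))
            + lam * l2_inner G (\<lambda>_. H0) (\<lambda>_. interp G (\<lambda>x. (\<xi> x \<bullet> q x) / (norm (q x))\<^sup>2)) = 0) \<and>
         (\<forall>\<eta>\<in>S_h G.
            l2_inner G (surf_grad G (\<lambda>x. (1/2) *\<^sub>R (u1 x + u0 x)))
                       (surf_grad G (\<lambda>x. \<eta> x *\<^sub>R \<nu> x))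
            = lumped_inner G H \<eta>) \<and>
         (surf_area (image_mesh X1 M) - surf_area (image_mesh X0 M)) / \<tau>
            + l2_inner G (\<lambda>_. H0) (\<lambda>_. H0) = 0)"

end

theory Submission
  imports Defs
begin

text \<open>The area inequality is the third equation of the scheme. For the volume, test the first
  equation with \<open>q\<close>, the projection of the averaged normal: the gradient term vanishes because
  \<open>Pmat \<nu> q *v q = 0\<close>, and the multiplier term because the interpolated factor is \<open>1\<close> and
  \<open>H\<close> minus its mean integrates to \<open>0\<close>. What remains says that the displacement is
  \<open>L\<^sup>2\<close>-orthogonal to the averaged normal. The enclosed volume is the sum of the signed volumes of
  the cones from the origin over the faces, a cubic polynomial along the linear path between the two
  surfaces; Simpson's rule for its derivative is exactly this inner product, up to edge terms that
  cancel in pairs because the surface is closed and coherently ordered.\<close>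

section \<open>Piecewise linear functions\<close>

lemma cross3_lin_indep:
  assumes "cross3 e f \<noteq> 0" "a *\<^sub>R e + b *\<^sub>R f = 0"
  shows "a = 0" "b = 0"
proof -
  have "a *\<^sub>R cross3 e f = cross3 (a *\<^sub>R e + b *\<^sub>R f) f"
    by (simp add: cross_add_left cross_mult_left)
  then show "a = 0" using assms by simp
  have "b *\<^sub>R cross3 e f = cross3 e (a *\<^sub>R e + b *\<^sub>R f)"
    by (simp add: cross_add_right cross_mult_right)
  then show "b = 0" using assms by simp
qed

definition bary :: "(3 \<Rightarrow> real) \<Rightarrow> bool" where
  "bary c \<longleftrightarrow> (\<forall>j. 0 \<le> c j) \<and> sum c UNIV = 1"

definition comb :: "(3 \<Rightarrow> real) \<Rightarrow> (3 \<Rightarrow> 'a::real_vector) \<Rightarrow> 'a" where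
  "comb c p = (\<Sum>j\<in>UNIV. c j *\<^sub>R p j)"

lemma range_3: "range (p :: 3 \<Rightarrow> 'a) = {p 1, p 2, p 3}"
  by (simp add: UNIV_3)

lemma tri_eq_comb: "tri p = {comb c p | c. bary c}"
proof (intro set_eqI iffI)
  fix x assume "x \<in> tri p"
  then obtain u v w where *: "0 \<le> u" "0 \<le> v" "0 \<le> w" "u + v + w = 1"
    "x = u *\<^sub>R p 1 + v *\<^sub>R p 2 + w *\<^sub>R p 3"
    unfolding tri_def range_3 convex_hull_3 by blast
  define c :: "3 \<Rightarrow> real" where "c = (\<lambda>j. if j = 1 then u else if j = 2 then v else w)"
  have "bary c" "x = comb c p"
    using * by (auto simp: bary_def comb_def sum_3 c_def forall_3)
  then show "x \<in> {comb c p | c. bary c}" by blast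
next
  fix x assume "x \<in> {comb c p | c. bary c}"
  then show "x \<in> tri p"
    unfolding tri_def range_3 convex_hull_3 by (fastforce simp: bary_def comb_def sum_3)
qed

lemma comb_in_tri: "bary c \<Longrightarrow> comb c p \<in> tri p"
  by (auto simp: tri_eq_comb)

lemma vertex_in_tri: "p j \<in> tri p"
  by (simp add: tri_def hull_inc)

lemma comb_unique:
  assumes "Jvec p \<noteq> 0" "sum c UNIV = sum d UNIV" "comb c p = comb d p"
  shows "c = d"
proof -
  have s: "c 1 = d 1 + (d 2 + d 3 - c 2 - c 3)"
    using assms(2) by (simp add: sum_3)
  have "(c 2 - d 2) *\<^sub>R (p 2 - p 1) + (c 3 - d 3) *\<^sub>R (p 3 - p 1) = comb c p - comb d p"
    unfolding comb_def sum_3 s by (simp add: algebra_simps)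
  then have "(c 2 - d 2) *\<^sub>R (p 2 - p 1) + (c 3 - d 3) *\<^sub>R (p 3 - p 1) = 0"
    using assms by simp
  from cross3_lin_indep[OF assms(1)[unfolded Jvec_def] this]
  show ?thesis using s by (auto simp: fun_eq_iff forall_3)
qed

lemma Jvec_nonzero_inj:
  assumes "Jvec p \<noteq> 0" shows "inj p"
proof -
  have "p 1 \<noteq> p 2" "p 1 \<noteq> p 3" "p 2 \<noteq> p 3"
    using assms by (auto simp: Jvec_def cross_refl)
  then show ?thesis by (auto simp: inj_def forall_3)
qed

lemma linear_imp_comb:
  assumes "linear A" "bary c" "\<And>x. x \<in> tri p \<Longrightarrow> f x = A x + b"
  shows "f (comb c p) = comb c (\<lambda>j. f (p j))"
proof -
  have s: "c 1 = 1 - c 2 - c 3" using assms(2) by (simp add: bary_def sum_3)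
  have "f (comb c p) = comb c (\<lambda>j. A (p j)) + b"
    using assms(1) comb_in_tri[OF assms(2)] assms(3)
    by (simp add: comb_def linear_sum linear_scale)
  also have "\<dots> = comb c (\<lambda>j. A (p j) + b)"
    by (simp add: comb_def sum_3 s algebra_simps)
  finally show ?thesis using assms(3) vertex_in_tri[of p] by simp
qed

lemma compact_tri: "compact (tri p)"
  by (simp add: tri_def finite_imp_compact_convex_hull)

lemma compact_surf: "compact (surf N)"
  unfolding surf_def by (intro compact_UN compact_tri) auto

text \<open>The linear part is written with cross products: for \<open>e = p 2 - p 1\<close>, \<open>f = p 3 - p 1\<close> the
  coefficients of \<open>a *\<^sub>R e + b *\<^sub>R f\<close> are recovered by pairing with \<open>Jvec p = cross3 e f\<close>.\<close>

lemma ex_linear_comb: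
  fixes g :: "3 \<Rightarrow> 'b::real_normed_vector"
  assumes "Jvec p \<noteq> 0"
  shows "\<exists>A b. linear A \<and> (\<forall>c. bary c \<longrightarrow> A (comb c p) + b = comb c g)"
proof -
  define e where "e = p 2 - p 1"
  define f where "f = p 3 - p 1"
  define J where "J = cross3 e f"
  have J: "J \<bullet> J \<noteq> 0" using assms by (simp add: J_def e_def f_def Jvec_def)
  define A where "A = (\<lambda>x. ((cross3 x f \<bullet> J) / (J \<bullet> J)) *\<^sub>R (g 2 - g 1) + ((cross3 e x \<bullet> J) / (J \<bullet> J)) *\<^sub>R (g 3 - g 1))"
  have lin: "linear A"
    unfolding A_def
    by (rule linearI) (simp_all add: cross_add_left cross_add_right cross_mult_left cross_mult_right
        inner_add_left add_divide_distrib scaleR_add_left algebra_simps)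
  have Ae: "A e = g 2 - g 1" and Af: "A f = g 3 - g 1"
    using J by (simp_all add: A_def J_def[symmetric])
  have "A (comb c p) + (g 1 - A (p 1)) = comb c g" if "bary c" for c
  proof -
    have s: "c 1 = 1 - c 2 - c 3" using that by (simp add: bary_def sum_3)
    have "comb c p = p 1 + c 2 *\<^sub>R e + c 3 *\<^sub>R f"
      unfolding comb_def sum_3 s e_def f_def by (simp add: algebra_simps)
    then have "A (comb c p) = A (p 1) + c 2 *\<^sub>R (g 2 - g 1) + c 3 *\<^sub>R (g 3 - g 1)"
      using lin by (simp add: linear_add linear_scale Ae Af)
    then show ?thesis unfolding comb_def sum_3 s by (simp add: algebra_simps)
  qed
  then show ?thesis using lin by blast
qed

lemma S_h_iff:
  fixes f :: "real^3 \<Rightarrow> 'b::real_normed_vector"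
  assumes nd: "\<And>k. Jvec (N k) \<noteq> 0"
  shows "f \<in> S_h N \<longleftrightarrow> (\<forall>k c. bary c \<longrightarrow> f (comb c (N k)) = comb c (\<lambda>j. f (N k j)))"
proof
  assume "f \<in> S_h N"
  then show "\<forall>k c. bary c \<longrightarrow> f (comb c (N k)) = comb c (\<lambda>j. f (N k j))"
    unfolding S_h_def using linear_imp_comb[where f = f] by blast
next
  assume *: "\<forall>k c. bary c \<longrightarrow> f (comb c (N k)) = comb c (\<lambda>j. f (N k j))"
  have aff: "\<exists>A b. linear A \<and> (\<forall>x\<in>tri (N k). f x = A x + b)" for k
  proof -
    obtain A b where "linear A" "\<forall>c. bary c \<longrightarrow> A (comb c (N k)) + b = comb c (\<lambda>j. f (N k j))"
      using ex_linear_comb[OF nd[of k], of "\<lambda>j. f (N k j)"] by blast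
    moreover have "\<forall>x\<in>tri (N k). f x = A x + b"
      using calculation * by (auto simp: tri_eq_comb)
    ultimately show ?thesis by blast
  qed
  have "continuous_on (tri (N k)) f" for k
  proof -
    obtain A b where A: "linear A" "\<forall>x\<in>tri (N k). f x = A x + b"
      using aff by blast
    have "continuous_on (tri (N k)) (\<lambda>x. A x + b)"
      using A(1) by (intro continuous_intros linear_continuous_on) (simp add: linear_conv_bounded_linear)
    then show ?thesis using A(2) by (simp cong: continuous_on_cong)
  qed
  then have "continuous_on (\<Union>k\<in>UNIV. tri (N k)) f"
    by (intro continuous_on_closed_Union) (auto intro: compact_imp_closed compact_tri)
  with aff show "f \<in> S_h N" by (simp add: S_h_def surf_def)
qed

lemma comb_subset:
  fixes g :: "real^3 \<Rightarrow> 'b::real_vector"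
  assumes "Jvec p \<noteq> 0" "A \<subseteq> range p" "sum c UNIV = 1" "sum u A = 1"
    "comb c p = (\<Sum>a\<in>A. u a *\<^sub>R a)"
  shows "comb c (\<lambda>j. g (p j)) = (\<Sum>a\<in>A. u a *\<^sub>R g a)"
proof -
  define d where "d = (\<lambda>j. if p j \<in> A then u (p j) else 0)"
  have inj: "inj p" using assms(1) by (rule Jvec_nonzero_inj)
  have bij: "bij_betw p {j. p j \<in> A} A"
    using inj assms(2) by (auto simp: bij_betw_def inj_def inj_on_def)
  have re: "comb d (\<lambda>j. h (p j)) = (\<Sum>a\<in>A. u a *\<^sub>R h a)" for h :: "real^3 \<Rightarrow> 'c::real_vector"
  proof -
    have "comb d (\<lambda>j. h (p j)) = (\<Sum>j\<in>{j. p j \<in> A}. u (p j) *\<^sub>R h (p j))"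
      unfolding comb_def d_def by (rule sum.mono_neutral_cong_right) auto
    also have "\<dots> = (\<Sum>a\<in>A. u a *\<^sub>R h a)"
      by (rule sum.reindex_bij_betw[OF bij])
    finally show ?thesis .
  qed
  have "sum d UNIV = 1"
    using re[of "\<lambda>_. 1::real"] assms(4) by (simp add: comb_def)
  moreover have "comb d p = comb c p"
    using re[of "\<lambda>x. x"] assms(5) by simp
  ultimately have "c = d"
    using comb_unique[OF assms(1)] assms(3) by metis
  then show ?thesis using re by simp
qed

lemma closed_surfaceD:
  assumes "closed_polyhedral_surface N"
  shows "Jvec (N k) \<noteq> 0"
    and "k \<noteq> l \<Longrightarrow> range (N k) \<noteq> range (N l)"
    and "tri (N k) \<inter> tri (N l) = convex hull (range (N k) \<inter> range (N l))"
proof -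
  show "Jvec (N k) \<noteq> 0" and "k \<noteq> l \<Longrightarrow> range (N k) \<noteq> range (N l)"
    using assms unfolding closed_polyhedral_surface_def by blast+
  show "tri (N k) \<inter> tri (N l) = convex hull (range (N k) \<inter> range (N l))"
  proof (cases "k = l")
    case True
    then show ?thesis by (simp add: tri_def)
  next
    case False
    then show ?thesis using assms unfolding closed_polyhedral_surface_def by blast
  qed
qed

lemma ex_interp:
  fixes g :: "real^3 \<Rightarrow> 'b::real_normed_vector"
  assumes N: "closed_polyhedral_surface N"
  shows "\<exists>f\<in>S_h N. \<forall>k j. f (N k j) = g (N k j)"
proof -
  note nd = closed_surfaceD(1)[OF N]
  define P where "P y z \<longleftrightarrow> (\<exists>k c. bary c \<and> y = comb c (N k) \<and> z = comb c (\<lambda>j. g (N k j)))" for y z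
  have uniq: "comb c (\<lambda>j. g (N k j)) = comb d (\<lambda>j. g (N l j))"
    if "bary c" "bary d" "comb c (N k) = comb d (N l)" for c d k l
  proof -
    let ?A = "range (N k) \<inter> range (N l)"
    have "comb c (N k) \<in> convex hull ?A"
      using closed_surfaceD(3)[OF N, of k l] that by (metis IntI comb_in_tri)
    moreover have "finite ?A" by simp
    ultimately obtain u where u: "sum u ?A = 1" "(\<Sum>a\<in>?A. u a *\<^sub>R a) = comb c (N k)"
      unfolding convex_hull_finite[OF \<open>finite ?A\<close>] by blast
    have "comb c (\<lambda>j. g (N k j)) = (\<Sum>a\<in>?A. u a *\<^sub>R g a)"
      using comb_subset[OF nd, of ?A k c u g] that(1) u by (simp add: bary_def)
    moreover have "comb d (\<lambda>j. g (N l j)) = (\<Sum>a\<in>?A. u a *\<^sub>R g a)"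
      using comb_subset[OF nd, of ?A l d u g] that(2,3) u by (simp add: bary_def)
    ultimately show ?thesis by simp
  qed
  define f where "f y = (SOME z. P y z)" for y
  have f: "f (comb c (N k)) = comb c (\<lambda>j. g (N k j))" if "bary c" for c k
  proof -
    have "P (comb c (N k)) (comb c (\<lambda>j. g (N k j)))" using that by (auto simp: P_def)
    then have "P (comb c (N k)) (f (comb c (N k)))" unfolding f_def by (rule someI)
    then show ?thesis using that uniq unfolding P_def by metis
  qed
  have vert: "f (N k i) = g (N k i)" for k i
  proof -
    define c :: "3 \<Rightarrow> real" where "c = (\<lambda>j. if j = i then 1 else 0)"
    have "bary c" by (simp add: bary_def c_def)
    moreover have "comb c h = h i" for h :: "3 \<Rightarrow> 'c::real_vector"
    proof -
      have "comb c h = (\<Sum>j\<in>UNIV. if j = i then h j else 0)"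
        unfolding comb_def c_def by (rule sum.cong) auto
      then show ?thesis by simp
    qed
    ultimately show ?thesis using f by metis
  qed
  have "f \<in> S_h N"
    using f by (subst S_h_iff[OF nd]) (simp add: vert)
  then show ?thesis using vert by blast
qed

lemma interp_spec:
  fixes f :: "real^3 \<Rightarrow> 'b::real_normed_vector"
  assumes "closed_polyhedral_surface N"
  shows "interp N f \<in> S_h N" "interp N f (N k j) = f (N k j)"
proof -
  have "\<exists>g. g \<in> S_h N \<and> (\<forall>k j. g (N k j) = f (N k j))"
    using ex_interp[OF assms, of f] by blast
  from someI_ex[OF this] show "interp N f \<in> S_h N" "interp N f (N k j) = f (N k j)"
    unfolding interp_def by blast+
qed

section \<open>Enclosed volume as a sum of signed cones\<close>

definition tdet :: "triangle \<Rightarrow> real" where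
  "tdet p = p 1 \<bullet> cross3 (p 2) (p 3)"

definition tcone :: "triangle \<Rightarrow> (real^3) set" where
  "tcone p = convex hull (insert 0 (range p))"

lemma vertex_inner_Jvec: "p j \<bullet> Jvec p = tdet p"
proof -
  have "\<forall>j. p j \<bullet> Jvec p = tdet p"
    unfolding forall_3 tdet_def Jvec_def by (simp add: cross3_simps)
  then show ?thesis by blast
qed

lemma tri_inner_Jvec: "x \<in> tri p \<Longrightarrow> x \<bullet> Jvec p = tdet p"
proof -
  assume "x \<in> tri p"
  then obtain c where c: "bary c" "x = comb c p" by (auto simp: tri_eq_comb)
  have "x \<bullet> Jvec p = (\<Sum>j\<in>UNIV. c j * tdet p)"
    by (simp add: c(2) comb_def inner_sum_left vertex_inner_Jvec)
  also have "\<dots> = tdet p"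
    using c(1) by (simp add: bary_def sum_distrib_right[symmetric])
  finally show ?thesis .
qed

lemma mem_tcone_iff:
  assumes "y \<noteq> 0"
  shows "y \<in> tcone p \<longleftrightarrow> (\<exists>s\<ge>1. s *\<^sub>R y \<in> tri p)"
proof
  assume "y \<in> tcone p"
  then obtain u v b where *: "u \<ge> 0" "v \<ge> 0" "u + v = 1" "b \<in> tri p" "y = u *\<^sub>R 0 + v *\<^sub>R b"
    unfolding tcone_def tri_def by (subst (asm) convex_hull_insert) auto
  then have "v > 0" using assms by (cases "v = 0") auto
  moreover have "(1 / v) *\<^sub>R y = b" "1 / v \<ge> 1" using * \<open>v > 0\<close> by auto
  ultimately show "\<exists>s\<ge>1. s *\<^sub>R y \<in> tri p" using * by metis
next
  assume "\<exists>s\<ge>1. s *\<^sub>R y \<in> tri p"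
  then obtain s where s: "s \<ge> 1" "s *\<^sub>R y \<in> tri p" by blast
  have "s *\<^sub>R y \<in> tcone p"
    using s(2) hull_mono[of "range p" "insert 0 (range p)" convex]
    unfolding tcone_def tri_def by (meson subsetD subset_insertI)
  moreover have "0 \<in> tcone p" by (simp add: tcone_def hull_inc)
  moreover have "convex (tcone p)" by (simp add: tcone_def)
  ultimately have "(1 / s) *\<^sub>R (s *\<^sub>R y) + (1 - 1 / s) *\<^sub>R 0 \<in> tcone p"
    using s(1) by (intro convexD) auto
  then show "y \<in> tcone p" using s(1) by simp
qed

lemma compact_tcone: "compact (tcone p)"
  by (simp add: tcone_def finite_imp_compact_convex_hull)

lemma tcone_degenerate:
  assumes "tdet p = 0" shows "tcone p \<subseteq> {x. Jvec p \<bullet> x = 0}"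
  unfolding tcone_def
proof (rule hull_minimal)
  show "insert 0 (range p) \<subseteq> {x. Jvec p \<bullet> x = 0}"
    using vertex_inner_Jvec[of p] assms by (auto simp: inner_commute)
  show "convex {x. Jvec p \<bullet> x = 0}" by (rule convex_hyperplane)
qed

lemma measure_tcone:
  assumes "Jvec p \<noteq> 0"
  shows "measure lebesgue (tcone p) = \<bar>tdet p\<bar> / 6"
proof (cases "tdet p = 0")
  case True
  then have "negligible (tcone p)"
    using tcone_degenerate[OF True] negligible_hyperplane[of "Jvec p" 0] assms
    by (meson negligible_subset)
  then show ?thesis using True by (simp add: negligible_imp_measure0)
next
  case False
  have inj: "inj p" using assms by (rule Jvec_nonzero_inj)
  have 0: "0 \<notin> range p"
    using vertex_inner_Jvec[of p] False by (metis image_iff inner_zero_left)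
  have "measure lborel (convex hull (insert 0 (range p))) =
      \<bar>det (\<chi> i. \<chi> j. p j $ i - 0 $ i)\<bar> / fact CARD(3)"
  proof (rule content_simplex)
    show "card (insert 0 (range p)) = Suc CARD(3)"
      using 0 inj by (simp add: card_image)
    show "bij_betw p UNIV (insert 0 (range p) - {0})"
      using 0 inj by (auto simp: bij_betw_def)
  qed auto
  also have "det (\<chi> i. \<chi> j. p j $ i - 0 $ i) = tdet p"
    by (simp add: tdet_def cross3_simps)
  finally have "measure lborel (tcone p) = \<bar>tdet p\<bar> / 6"
    by (simp add: tcone_def fact_numeral)
  then show ?thesis
    using compact_tcone[of p] by (simp add: measure_completion compact_imp_closed borel_closed)
qed

lemma convex_inside_iff:
  fixes C S :: "'a::real_normed_vector set"
  assumes "convex C" "C \<inter> S = {}" "x \<in> C" "y \<in> C"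
  shows "x \<in> inside S \<longleftrightarrow> y \<in> inside S"
proof -
  have "y \<in> connected_component_set (- S) x"
    using connected_component_maximal[OF assms(3) convex_connected[OF assms(1)], of "- S"] assms(2,4)
    by blast
  then have "connected_component_set (- S) x = connected_component_set (- S) y"
    by (simp add: connected_component_eq)
  then show ?thesis using assms by (auto simp: inside_def)
qed

lemma inside_near_face:
  assumes "closed_polyhedral_surface N" "outward_oriented N"
    and x0: "x0 \<in> rel_interior (tri (N k))" and other: "\<And>l. l \<noteq> k \<Longrightarrow> x0 \<notin> tri (N l)"
  shows "\<exists>r>0. \<forall>y. dist y x0 < r \<longrightarrow>
      ((y - x0) \<bullet> Jvec (N k) < 0 \<longrightarrow> y \<in> inside (surf N)) \<and>
      ((y - x0) \<bullet> Jvec (N k) > 0 \<longrightarrow> y \<notin> inside (surf N))"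
proof -
  define J where "J = Jvec (N k)"
  have J: "J \<noteq> 0" using closed_surfaceD(1)[OF assms(1)] by (simp add: J_def)
  define n where "n = unit_normal N k"
  have n: "n = (1 / norm J) *\<^sub>R J" by (simp add: n_def unit_normal_def J_def sgn_div_norm divide_inverse)
  have x0k: "x0 \<in> tri (N k)" using x0 rel_interior_subset by blast
  have "closed (\<Union>l\<in>-{k}. tri (N l))"
    by (intro closed_UN) (auto intro: compact_imp_closed compact_tri)
  then have "open (- (\<Union>l\<in>-{k}. tri (N l)))" by (rule open_Compl)
  moreover have "x0 \<in> - (\<Union>l\<in>-{k}. tri (N l))" using other by auto
  ultimately obtain r where r: "r > 0" "ball x0 r \<subseteq> - (\<Union>l\<in>-{k}. tri (N l))"
    using open_contains_ball by meson
  define B1 where "B1 = ball x0 r \<inter> {y. J \<bullet> y > J \<bullet> x0}"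
  define B2 where "B2 = ball x0 r \<inter> {y. J \<bullet> y < J \<bullet> x0}"
  have conv: "convex B1" "convex B2"
    unfolding B1_def B2_def by (auto intro: convex_Int convex_halfspace_gt convex_halfspace_lt)
  have plane: "y \<in> tri (N k) \<Longrightarrow> J \<bullet> y = J \<bullet> x0" for y
    using tri_inner_Jvec x0k by (simp add: J_def inner_commute)
  have disj: "B1 \<inter> surf N = {}" "B2 \<inter> surf N = {}"
  proof -
    have "y \<notin> surf N" if "y \<in> ball x0 r" "J \<bullet> y \<noteq> J \<bullet> x0" for y
    proof
      assume "y \<in> surf N"
      then obtain l where "y \<in> tri (N l)" by (auto simp: surf_def)
      then show False using that plane r(2) by (cases "l = k") auto
    qed
    then show "B1 \<inter> surf N = {}" "B2 \<inter> surf N = {}"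
      unfolding B1_def B2_def by fastforce+
  qed
  have "\<forall>\<^sub>F e in at_right (0::real). x0 + e *\<^sub>R n \<in> outside (surf N) \<and> x0 - e *\<^sub>R n \<in> inside (surf N)"
    using assms(2) x0 unfolding outward_oriented_def n_def by blast
  moreover have "\<forall>\<^sub>F e in at_right (0::real). e < r"
    using r(1) by (intro eventually_at_rightI[of 0 r]) auto
  moreover have "\<forall>\<^sub>F e in at_right (0::real). 0 < e"
    by (simp add: eventually_at_right_less)
  ultimately have "\<forall>\<^sub>F e in at_right (0::real). x0 + e *\<^sub>R n \<in> outside (surf N) \<and>
      x0 - e *\<^sub>R n \<in> inside (surf N) \<and> e < r \<and> 0 < e"
    by eventually_elim auto
  then obtain e where e: "x0 + e *\<^sub>R n \<in> outside (surf N)" "x0 - e *\<^sub>R n \<in> inside (surf N)" "e < r" "0 < e"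
    by (metis (mono_tags, lifting) eventually_happens trivial_limit_at_right_real)
  have nn: "norm n = 1" using J by (simp add: n)
  have Jn: "J \<bullet> n > 0" using J by (simp add: n)
  have "x0 + e *\<^sub>R n \<in> B1" "x0 - e *\<^sub>R n \<in> B2"
    using e nn Jn unfolding B1_def B2_def by (auto simp: dist_norm algebra_simps)
  have "y \<in> B1 \<Longrightarrow> y \<notin> inside (surf N)" for y
    using convex_inside_iff[OF conv(1) disj(1) _ \<open>x0 + e *\<^sub>R n \<in> B1\<close>] e(1) inside_Int_outside by blast
  moreover have "y \<in> B2 \<Longrightarrow> y \<in> inside (surf N)" for y
    using convex_inside_iff[OF conv(2) disj(2) _ \<open>x0 - e *\<^sub>R n \<in> B2\<close>] e(2) by blast
  ultimately show ?thesis
    using r(1) unfolding B1_def B2_def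
    by (intro exI[of _ r]) (auto simp: J_def[symmetric] inner_diff_left inner_diff_right inner_commute dist_commute)
qed

definition edge_planes :: "'k::finite mesh \<Rightarrow> (real^3) set" where
  "edge_planes N = (\<Union>k. (\<Union>j. span {N k j, N k (j + 1)}) \<union>
     (if tdet (N k) = 0 then {x. Jvec (N k) \<bullet> x = 0} else {}))"

lemma negligible_span_pair: "negligible (span {a, b :: real^3})"
proof -
  have "dim {a, b} \<le> card {a, b}" by (rule dim_le_card') simp
  also have "\<dots> \<le> 2" by (simp add: card_insert_if)
  finally have "dim {a, b} < DIM(real^3)" by simp
  from lowdim_subset_hyperplane[OF this] obtain c where "c \<noteq> 0" "span {a, b} \<subseteq> {x. c \<bullet> x = 0}"
    by blast
  then show ?thesis using negligible_hyperplane[of c 0] negligible_subset by blast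
qed

lemma negligible_edge_planes:
  assumes "\<And>k. Jvec (N k) \<noteq> 0"
  shows "negligible (edge_planes N)"
  unfolding edge_planes_def using assms
  by (intro negligible_Union) (auto intro!: negligible_Union negligible_Un negligible_span_pair negligible_hyperplane)

lemma negligible_surf:
  assumes "\<And>k. Jvec (N k) \<noteq> 0"
  shows "negligible (surf N)"
proof -
  have "tri (N k) \<subseteq> {x. Jvec (N k) \<bullet> x = tdet (N k)}" for k
    using tri_inner_Jvec[of _ "N k"] by (auto simp: inner_commute)
  then have "negligible (tri (N k))" for k
    using negligible_hyperplane[of "Jvec (N k)"] assms negligible_subset by metis
  then show ?thesis unfolding surf_def by (intro negligible_Union) auto
qed

lemma scale_notin_edge_planes:
  assumes "x \<notin> edge_planes N" "s \<noteq> 0"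
  shows "s *\<^sub>R x \<notin> edge_planes N"
proof
  assume "s *\<^sub>R x \<in> edge_planes N"
  then obtain k where "(\<exists>j. s *\<^sub>R x \<in> span {N k j, N k (j + 1)}) \<or>
      tdet (N k) = 0 \<and> Jvec (N k) \<bullet> (s *\<^sub>R x) = 0"
    by (auto simp: edge_planes_def split: if_splits)
  moreover have "x \<in> span A" if "s *\<^sub>R x \<in> span A" for A
    using span_scale[OF that, of "1 / s"] assms(2) by simp
  ultimately have "(\<exists>j. x \<in> span {N k j, N k (j + 1)}) \<or> tdet (N k) = 0 \<and> Jvec (N k) \<bullet> x = 0"
    using assms(2) by auto
  then have "x \<in> edge_planes N" unfolding edge_planes_def by auto
  then show False using assms(1) by simp
qed

lemma edge_cover:
  fixes p :: triangle
  assumes "A \<subseteq> range p - {p i}"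
  shows "\<exists>j. A \<subseteq> {p j, p (j + 1)}"
proof -
  consider "i = 1" | "i = 2" | "i = 3" using exhaust_3 by blast
  then show ?thesis
  proof cases
    case 1
    then have "A \<subseteq> {p 2, p (2 + 1)}" using assms by (auto simp: range_3)
    then show ?thesis by blast
  next
    case 2
    then have "A \<subseteq> {p 3, p 1}" using assms by (auto simp: range_3)
    moreover have "(3::3) + 1 = 1" by simp
    then have "p (3 + 1) = p 1" by (rule arg_cong)
    ultimately have "A \<subseteq> {p 3, p (3 + 1)}" by simp
    then show ?thesis by blast
  next
    case 3
    then have "A \<subseteq> {p 1, p (1 + 1)}" using assms by (auto simp: range_3)
    then show ?thesis by blast
  qed
qed

lemma convex_hull_edge_planes:
  assumes "A \<subseteq> range (N k) - {N k i}"
  shows "convex hull A \<subseteq> edge_planes N"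
proof -
  obtain j where "A \<subseteq> {N k j, N k (j + 1)}" using edge_cover[OF assms] by blast
  then have "convex hull A \<subseteq> span {N k j, N k (j + 1)}"
    using convex_hull_subset_span span_mono by blast
  then show ?thesis unfolding edge_planes_def by fastforce
qed

lemma generic_point_tri:
  assumes N: "closed_polyhedral_surface N" and x: "x \<notin> edge_planes N" and k: "x \<in> tri (N k)"
  shows "x \<in> rel_interior (tri (N k))" "l \<noteq> k \<Longrightarrow> x \<notin> tri (N l)" "tdet (N k) \<noteq> 0"
proof -
  note nd = closed_surfaceD(1)[OF N]
  show "tdet (N k) \<noteq> 0"
  proof
    assume "tdet (N k) = 0"
    then have "x \<in> (if tdet (N k) = 0 then {x. Jvec (N k) \<bullet> x = 0} else {})"
      using tri_inner_Jvec[OF k] by (simp add: inner_commute)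
    then show False using x unfolding edge_planes_def by blast
  qed
  have inj: "inj (N k)" for k using nd by (rule Jvec_nonzero_inj)
  obtain c where c: "bary c" "x = comb c (N k)" using k by (auto simp: tri_eq_comb)
  define u where "u = c \<circ> inv (N k)"
  have u: "u (N k j) = c j" for j using inj by (simp add: u_def)
  have sums: "sum u (range (N k)) = 1" "(\<Sum>a\<in>range (N k). u a *\<^sub>R a) = x"
    using c inj[of k] by (simp_all add: sum.reindex u bary_def comb_def)
  have pos: "0 < c i" for i
  proof (rule ccontr)
    assume "\<not> 0 < c i"
    then have "c i = 0" using c(1) by (auto simp: bary_def order.antisym)
    have ri: "range (N k) = insert (N k i) (range (N k) - {N k i})" by auto
    have "sum u (range (N k) - {N k i}) = 1" "(\<Sum>a\<in>range (N k) - {N k i}. u a *\<^sub>R a) = x"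
      using sums u[of i] \<open>c i = 0\<close> by (simp_all add: sum_diff1)
    moreover have "\<forall>a\<in>range (N k) - {N k i}. 0 \<le> u a" using u c(1) by (auto simp: bary_def)
    ultimately have "x \<in> convex hull (range (N k) - {N k i})"
      unfolding convex_hull_finite[OF finite_Diff[OF finite_imageI[OF finite]]] by blast
    then show False using x convex_hull_edge_planes[of "range (N k) - {N k i}" N k i] by blast
  qed
  show "x \<in> rel_interior (tri (N k))"
    unfolding tri_def
  proof (rule subsetD[OF explicit_subset_rel_interior_convex_hull_minimal])
    have "\<forall>a\<in>range (N k). 0 < u a" using pos u by auto
    then show "x \<in> {y. \<exists>u. (\<forall>x\<in>range (N k). 0 < u x) \<and> sum u (range (N k)) = 1 \<and>
        (\<Sum>x\<in>range (N k). u x *\<^sub>R x) = y}"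
      using sums by blast
  qed simp
  show "x \<notin> tri (N l)" if "l \<noteq> k"
  proof
    assume "x \<in> tri (N l)"
    then have "x \<in> convex hull (range (N k) \<inter> range (N l))"
      using k closed_surfaceD(3)[OF N, of k l] by blast
    moreover have "\<not> range (N k) \<subseteq> range (N l)"
    proof
      assume "range (N k) \<subseteq> range (N l)"
      moreover have "card (range (N k)) = card (range (N l))"
        using inj by (simp add: card_image)
      ultimately have "range (N k) = range (N l)" by (intro card_subset_eq) auto
      then show False using closed_surfaceD(2)[OF N that] by simp
    qed
    then obtain i where "N k i \<notin> range (N l)" by blast
    then have "range (N k) \<inter> range (N l) \<subseteq> range (N k) - {N k i}" by auto
    ultimately show False using convex_hull_edge_planes x by blast
  qed
qed

lemma ray_meets_tri_once:
  assumes "x \<notin> edge_planes N" "s *\<^sub>R x \<in> tri (N k)" "s' *\<^sub>R x \<in> tri (N k)"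
    and "tdet (N k) \<noteq> 0"
  shows "s = s'"
proof -
  have "s * (x \<bullet> Jvec (N k)) = s' * (x \<bullet> Jvec (N k))"
    using tri_inner_Jvec[OF assms(2)] tri_inner_Jvec[OF assms(3)] by simp
  moreover have "x \<bullet> Jvec (N k) \<noteq> 0"
    using tri_inner_Jvec[OF assms(2)] assms(4) by auto
  ultimately show ?thesis by simp
qed

lemma ray_tcone_iff:
  assumes "x \<noteq> 0" "s > 0"
  shows "s *\<^sub>R x \<in> tcone p \<longleftrightarrow> (\<exists>s'\<ge>s. s' *\<^sub>R x \<in> tri p)"
proof -
  have "(\<exists>r\<ge>1. r *\<^sub>R s *\<^sub>R x \<in> tri p) \<longleftrightarrow> (\<exists>s'\<ge>s. s' *\<^sub>R x \<in> tri p)"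
  proof
    assume "\<exists>r\<ge>1. r *\<^sub>R s *\<^sub>R x \<in> tri p"
    then obtain r where "r \<ge> 1" "(r * s) *\<^sub>R x \<in> tri p" by auto
    then show "\<exists>s'\<ge>s. s' *\<^sub>R x \<in> tri p" using assms(2) by (intro exI[of _ "r * s"]) auto
  next
    assume "\<exists>s'\<ge>s. s' *\<^sub>R x \<in> tri p"
    then obtain s' where "s' \<ge> s" "s' *\<^sub>R x \<in> tri p" by auto
    then show "\<exists>r\<ge>1. r *\<^sub>R s *\<^sub>R x \<in> tri p" using assms(2) by (intro exI[of _ "s' / s"]) auto
  qed
  then show ?thesis using mem_tcone_iff[of "s *\<^sub>R x" p] assms by simp
qed

lemma ray_tcone_locally_constant:
  assumes "x \<noteq> 0" "s0 > 0" "s0 *\<^sub>R x \<notin> tri p"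
  shows "\<forall>\<^sub>F s in nhds s0. s *\<^sub>R x \<in> tcone p \<longleftrightarrow> s0 *\<^sub>R x \<in> tcone p"
proof -
  have "closed ((\<lambda>s. s *\<^sub>R x) -` tri p)"
    by (intro continuous_closed_vimage compact_imp_closed compact_tri) (auto intro!: continuous_intros)
  then have "open (- ((\<lambda>s. s *\<^sub>R x) -` tri p) \<inter> {0<..})" by (intro open_Int) auto
  moreover have "s0 \<in> - ((\<lambda>s. s *\<^sub>R x) -` tri p) \<inter> {0<..}" using assms by auto
  ultimately obtain e where e: "e > 0" "ball s0 e \<subseteq> - ((\<lambda>s. s *\<^sub>R x) -` tri p) \<inter> {0<..}"
    using open_contains_ball by meson
  have "s *\<^sub>R x \<in> tcone p \<longleftrightarrow> s0 *\<^sub>R x \<in> tcone p" if s: "dist s s0 < e" for s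
  proof -
    have "s > 0" using e(2) s by (auto simp: dist_commute)
    have "r *\<^sub>R x \<notin> tri p" if "dist r s0 < e" for r
    proof -
      have "r \<in> ball s0 e" using that by (simp add: dist_commute)
      then show ?thesis using e(2) by blast
    qed
    then have "(\<exists>s'\<ge>s. s' *\<^sub>R x \<in> tri p) \<longleftrightarrow> (\<exists>s'\<ge>s0. s' *\<^sub>R x \<in> tri p)"
      using s unfolding dist_real_def by (smt (verit))
    then show ?thesis using ray_tcone_iff[of x _ p] assms \<open>s > 0\<close> by simp
  qed
  then show ?thesis using e(1) unfolding eventually_nhds_metric by blast
qed

text \<open>The quantity shown to vanish at generic points: crossing a face whose outward normal points
  away from the origin leaves both the enclosed region and the cone over that face; crossing one
  whose normal points towards the origin enters the region and leaves the (negatively counted)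
  cone.\<close>

definition ray_defect :: "'k::finite mesh \<Rightarrow> real^3 \<Rightarrow> real" where
  "ray_defect N x = indicator (inside (surf N)) x
     - (\<Sum>k\<in>UNIV. sgn (tdet (N k)) * indicator (tcone (N k)) x)"

lemma ray_defect_locally_constant:
  assumes N: "closed_polyhedral_surface N" "outward_oriented N"
    and x: "x \<noteq> 0" "x \<notin> edge_planes N" and s0: "s0 > 0"
  shows "\<exists>c. (\<forall>\<^sub>F s in at s0. ray_defect N (s *\<^sub>R x) = c) \<and>
    (s0 *\<^sub>R x \<notin> surf N \<longrightarrow> ray_defect N (s0 *\<^sub>R x) = c)"
proof (cases "s0 *\<^sub>R x \<in> surf N")
  case False
  have "open (- surf N)" using compact_surf by (intro open_Compl compact_imp_closed)
  then obtain r where r: "r > 0" "ball (s0 *\<^sub>R x) r \<subseteq> - surf N"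
    using False open_contains_ball by (metis ComplI)
  have "((\<lambda>s. s *\<^sub>R x) \<longlongrightarrow> s0 *\<^sub>R x) (nhds s0)" by (intro tendsto_intros filterlim_ident)
  then have "\<forall>\<^sub>F s in nhds s0. s *\<^sub>R x \<in> ball (s0 *\<^sub>R x) r"
    using r(1) by (intro topological_tendstoD) auto
  then have "\<forall>\<^sub>F s in nhds s0. s *\<^sub>R x \<in> inside (surf N) \<longleftrightarrow> s0 *\<^sub>R x \<in> inside (surf N)"
  proof eventually_elim
    case (elim s)
    then show ?case
      using r by (intro convex_inside_iff[of "ball (s0 *\<^sub>R x) r"]) auto
  qed
  moreover have "\<forall>\<^sub>F s in nhds s0. \<forall>k. s *\<^sub>R x \<in> tcone (N k) \<longleftrightarrow> s0 *\<^sub>R x \<in> tcone (N k)"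
    using False by (intro eventually_all_finite ray_tcone_locally_constant x s0) (auto simp: surf_def)
  ultimately have "\<forall>\<^sub>F s in nhds s0. ray_defect N (s *\<^sub>R x) = ray_defect N (s0 *\<^sub>R x)"
    by eventually_elim (simp add: ray_defect_def indicator_def)
  then have "\<forall>\<^sub>F s in at s0. ray_defect N (s *\<^sub>R x) = ray_defect N (s0 *\<^sub>R x)"
    by (simp add: eventually_at_filter eventually_mono)
  then show ?thesis by blast
next
  case True
  then obtain k where k: "s0 *\<^sub>R x \<in> tri (N k)" by (auto simp: surf_def)
  have gen: "s0 *\<^sub>R x \<notin> edge_planes N" using x(2) s0 by (intro scale_notin_edge_planes) auto
  note gp = generic_point_tri[OF N(1) gen k]
  define D where "D = tdet (N k)"
  have D: "D \<noteq> 0" using gp(3) by (simp add: D_def)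
  have xJ: "x \<bullet> Jvec (N k) = D / s0"
    using tri_inner_Jvec[OF k] s0 by (simp add: D_def field_simps)
  obtain r where r: "r > 0" and rn: "\<And>y. dist y (s0 *\<^sub>R x) < r \<Longrightarrow>
      ((y - s0 *\<^sub>R x) \<bullet> Jvec (N k) < 0 \<longrightarrow> y \<in> inside (surf N)) \<and>
      ((y - s0 *\<^sub>R x) \<bullet> Jvec (N k) > 0 \<longrightarrow> y \<notin> inside (surf N))"
    using inside_near_face[OF N gp(1,2)] by blast
  have "((\<lambda>s. s *\<^sub>R x) \<longlongrightarrow> s0 *\<^sub>R x) (nhds s0)" by (intro tendsto_intros filterlim_ident)
  then have 1: "\<forall>\<^sub>F s in nhds s0. dist (s *\<^sub>R x) (s0 *\<^sub>R x) < r"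
    using r(1) by (rule tendstoD)
  have 2: "\<forall>\<^sub>F s in nhds s0. \<forall>l. l \<noteq> k \<longrightarrow> (s *\<^sub>R x \<in> tcone (N l) \<longleftrightarrow> s0 *\<^sub>R x \<in> tcone (N l))"
  proof (intro eventually_all_finite)
    fix l show "\<forall>\<^sub>F s in nhds s0. l \<noteq> k \<longrightarrow> (s *\<^sub>R x \<in> tcone (N l) \<longleftrightarrow> s0 *\<^sub>R x \<in> tcone (N l))"
      using ray_tcone_locally_constant[OF x(1) s0, of "N l"] gp(2)[of l] by (cases "l = k") auto
  qed
  have 3: "\<forall>\<^sub>F s in nhds s0. 0 < s" using s0 by (rule order_tendstoD(1)[OF filterlim_ident])
  define c where "c = (if D > 0 then 0 else 1) -
     (\<Sum>l\<in>-{k}. sgn (tdet (N l)) * indicator (tcone (N l)) (s0 *\<^sub>R x) :: real)"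
  have "\<forall>\<^sub>F s in nhds s0. s \<noteq> s0 \<longrightarrow> ray_defect N (s *\<^sub>R x) = c"
    using 1 2 3
  proof eventually_elim
    case (elim s)
    show ?case
    proof
      assume "s \<noteq> s0"
      have ck: "s *\<^sub>R x \<in> tcone (N k) \<longleftrightarrow> s < s0"
        using ray_tcone_iff[OF x(1) \<open>0 < s\<close>, of "N k"] ray_meets_tri_once[OF x(2) k _ gp(3)] k \<open>s \<noteq> s0\<close>
        by (metis less_eq_real_def)
      have "(s *\<^sub>R x - s0 *\<^sub>R x) \<bullet> Jvec (N k) = (s - s0) * (D / s0)"
        using xJ by (simp flip: scaleR_diff_left)
      then have ins: "((s - s0) * (D / s0) < 0 \<longrightarrow> s *\<^sub>R x \<in> inside (surf N)) \<and>
          ((s - s0) * (D / s0) > 0 \<longrightarrow> s *\<^sub>R x \<notin> inside (surf N))"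
        using rn[OF elim(1)] by simp
      have "ray_defect N (s *\<^sub>R x) = indicator (inside (surf N)) (s *\<^sub>R x)
          - sgn D * indicator (tcone (N k)) (s *\<^sub>R x)
          - (\<Sum>l\<in>-{k}. sgn (tdet (N l)) * indicator (tcone (N l)) (s *\<^sub>R x))"
        unfolding ray_defect_def D_def Compl_eq_Diff_UNIV by (subst sum.remove[of UNIV k]) auto
      also have "(\<Sum>l\<in>-{k}. sgn (tdet (N l)) * indicator (tcone (N l)) (s *\<^sub>R x)) =
          (\<Sum>l\<in>-{k}. sgn (tdet (N l)) * indicator (tcone (N l)) (s0 *\<^sub>R x) :: real)"
        using elim(2) by (intro sum.cong) (auto simp: indicator_def)
      also have "indicator (inside (surf N)) (s *\<^sub>R x) - sgn D * indicator (tcone (N k)) (s *\<^sub>R x)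
          = (if D > 0 then 0 else 1 :: real)"
      proof -
        consider "D > 0" "s < s0" | "D > 0" "s > s0" | "D < 0" "s < s0" | "D < 0" "s > s0"
          using D \<open>s \<noteq> s0\<close> by linarith
        then show ?thesis
        proof cases
          case 1
          then have "(s - s0) * (D / s0) < 0" using s0 by (intro mult_neg_pos) auto
          then show ?thesis using 1 ins ck by simp
        next
          case 2
          then have "(s - s0) * (D / s0) > 0" using s0 by (intro mult_pos_pos) auto
          then show ?thesis using 2 ins ck by simp
        next
          case 3
          then have "(s - s0) * (D / s0) > 0" using s0 by (intro mult_neg_neg) (auto simp: divide_neg_pos)
          then show ?thesis using 3 ins ck by simp
        next
          case 4
          then have "(s - s0) * (D / s0) < 0" using s0 by (intro mult_pos_neg) (auto simp: divide_neg_pos)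
          then show ?thesis using 4 ins ck by simp
        qed
      qed
      finally show "ray_defect N (s *\<^sub>R x) = c" by (simp add: c_def)
    qed
  qed
  then have "\<forall>\<^sub>F s in at s0. ray_defect N (s *\<^sub>R x) = c"
    by (simp add: eventually_at_filter)
  then show ?thesis using True by blast
qed

lemma ray_defect_generic:
  assumes N: "closed_polyhedral_surface N" "outward_oriented N"
    and x: "x \<notin> edge_planes N" "x \<notin> surf N"
  shows "ray_defect N x = 0"
proof -
  have "0 \<in> edge_planes N" by (auto simp: edge_planes_def span_zero)
  then have x0: "x \<noteq> 0" using x by auto
  define P where "P s0 \<longleftrightarrow> (\<forall>\<^sub>F s in at s0. ray_defect N (s *\<^sub>R x) = 0)" for s0
  have "bounded (inside (surf N) \<union> (\<Union>k. tcone (N k)))"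
    by (intro bounded_Un[THEN iffD2] conjI bounded_inside bounded_UN ballI finite
        compact_imp_bounded[OF compact_surf] compact_imp_bounded[OF compact_tcone])
  then obtain R where R: "\<And>y. y \<in> inside (surf N) \<union> (\<Union>k. tcone (N k)) \<Longrightarrow> norm y \<le> R"
    unfolding bounded_iff by blast
  have far: "ray_defect N (s *\<^sub>R x) = 0" if "s > \<bar>R\<bar> / norm x" for s
  proof -
    have "\<bar>R\<bar> < s * norm x" using that x0 by (simp add: divide_less_eq)
    also have "\<dots> \<le> \<bar>s\<bar> * norm x" by (intro mult_right_mono) auto
    finally have "norm (s *\<^sub>R x) > R" by simp
    then have "s *\<^sub>R x \<notin> inside (surf N)" "\<And>k. s *\<^sub>R x \<notin> tcone (N k)"
      using R[of "s *\<^sub>R x"] by auto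
    then show ?thesis by (simp add: ray_defect_def)
  qed
  define S where "S = \<bar>R\<bar> / norm x + 1"
  have "S > 0" unfolding S_def by (intro add_nonneg_pos) auto
  have "\<forall>\<^sub>F s in nhds S. s > \<bar>R\<bar> / norm x"
    by (rule order_tendstoD(1)[OF filterlim_ident]) (simp add: S_def)
  then have "P S" unfolding P_def eventually_at_filter by eventually_elim (simp add: far)
  have "P 1"
  proof (rule connected_induction_simple[of "{0<..}" S 1 P])
    fix s0 :: real assume "s0 \<in> {0<..}"
    then obtain c where "\<forall>\<^sub>F s in at s0. ray_defect N (s *\<^sub>R x) = c"
      using ray_defect_locally_constant[OF N x0 x(1)] by auto
    then obtain T where T: "open T" "s0 \<in> T" "\<And>s. s \<in> T \<Longrightarrow> s \<noteq> s0 \<Longrightarrow> ray_defect N (s *\<^sub>R x) = c"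
      unfolding eventually_at_topological by auto
    have "P s \<longleftrightarrow> c = 0" if "s \<in> T" for s
    proof -
      have "\<forall>\<^sub>F r in at s. ray_defect N (r *\<^sub>R x) = c"
      proof (cases "s = s0")
        case True
        then show ?thesis using T unfolding eventually_at_topological by blast
      next
        case False
        then have "open (T - {s0})" "s \<in> T - {s0}" using T(1) that by auto
        then show ?thesis using T(3) unfolding eventually_at_topological by blast
      qed
      then have "\<forall>\<^sub>F r in at s. (ray_defect N (r *\<^sub>R x) = 0) = (c = 0)"
        by eventually_elim simp
      then have "P s \<longleftrightarrow> (\<forall>\<^sub>F r in at s. c = 0)"
        unfolding P_def by (rule eventually_subst)
      then show ?thesis by simp
    qed
    then show "\<exists>T. openin (top_of_set {0<..}) T \<and> s0 \<in> T \<and> (\<forall>x\<in>T. \<forall>y\<in>T. P x \<longrightarrow> P y)"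
      using T(1,2) \<open>s0 \<in> {0<..}\<close> by (intro exI[of _ "{0<..} \<inter> T"]) auto
  qed (use \<open>S > 0\<close> \<open>P S\<close> in auto)
  obtain c where c: "\<forall>\<^sub>F s in at 1. ray_defect N (s *\<^sub>R x) = c" "ray_defect N x = c"
    using ray_defect_locally_constant[OF N x0 x(1) zero_less_one] x(2) unfolding scaleR_one by blast
  have "\<forall>\<^sub>F s in at (1::real). ray_defect N x = 0"
    using \<open>P 1\<close> c(1) unfolding P_def c(2) by eventually_elim simp
  then show ?thesis by simp
qed

lemma enclosed_volume_eq:
  assumes N: "closed_polyhedral_surface N" "outward_oriented N"
  shows "enclosed_volume N = (\<Sum>k\<in>UNIV. tdet (N k)) / 6"
proof -
  note nd = closed_surfaceD(1)[OF N(1)]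
  have cone: "(indicator (tcone (N k)) has_integral \<bar>tdet (N k)\<bar> / 6) UNIV" for k
    using lmeasurable_iff_has_integral[of "tcone (N k)"] lmeasurable_compact[OF compact_tcone]
      measure_tcone[OF nd] by metis
  have "((\<lambda>x. \<Sum>k\<in>UNIV. sgn (tdet (N k)) * indicator (tcone (N k)) x) has_integral
      (\<Sum>k\<in>UNIV. sgn (tdet (N k)) * (\<bar>tdet (N k)\<bar> / 6))) UNIV"
    by (intro has_integral_sum has_integral_mult_right cone) auto
  moreover have "sgn d * (\<bar>d\<bar> / 6) = d / 6" for d :: real
    by (simp add: sgn_if)
  ultimately have sums: "((\<lambda>x. \<Sum>k\<in>UNIV. sgn (tdet (N k)) * indicator (tcone (N k)) x) has_integral
      (\<Sum>k\<in>UNIV. tdet (N k)) / 6) UNIV"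
    by (simp add: sum_divide_distrib)
  have "((indicator (inside (surf N)) :: real^3 \<Rightarrow> real) has_integral (\<Sum>k\<in>UNIV. tdet (N k)) / 6) UNIV"
  proof (rule has_integral_spike[OF _ _ sums])
    show "negligible (edge_planes N \<union> surf N)"
      using nd by (intro negligible_Un negligible_edge_planes negligible_surf)
    fix x assume "x \<in> UNIV - (edge_planes N \<union> surf N)"
    then have "ray_defect N x = 0" using N by (intro ray_defect_generic) auto
    then show "indicator (inside (surf N)) x = (\<Sum>k\<in>UNIV. sgn (tdet (N k)) * indicator (tcone (N k)) x :: real)"
      by (simp add: ray_defect_def)
  qed
  moreover have "inside (surf N) \<in> lmeasurable"
    using compact_surf[of N]
    by (intro lmeasurable_open bounded_inside open_inside) (auto intro: compact_imp_bounded compact_imp_closed)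
  ultimately show ?thesis
    unfolding enclosed_volume_def lmeasurable_iff_has_integral by (rule has_integral_unique[rotated])
qed

section \<open>Integrals over triangles and the lumped projection\<close>

lemma integral_std_triangle:
  fixes f :: "real \<times> real \<Rightarrow> real"
  assumes f: "\<And>s t. (s, t) \<in> T \<Longrightarrow> f (s, t) = a + b * s + c * t"
    and T: "T = {(s, t). 0 \<le> s \<and> 0 \<le> t \<and> s + t \<le> 1}"
  shows "(f has_integral (3 * a + b + c) / 6) T"
proof -
  let ?g = "\<lambda>q::real \<times> real. a + b * fst q + c * snd q"
  have Teq: "T = {q. 0 \<le> fst q} \<inter> {q. 0 \<le> snd q} \<inter> {q. fst q + snd q \<le> 1}"
    unfolding T by auto
  have "T \<subseteq> cbox (0, 0) (1, 1)" unfolding T by (auto simp: mem_box Basis_prod_def)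
  then have "bounded T" using bounded_cbox bounded_subset by blast
  moreover have "closed T"
    unfolding Teq by (intro closed_Int closed_Collect_le continuous_intros)
  ultimately have T_comp: "compact T" by (simp add: compact_eq_bounded_closed)
  have "integrable lborel (\<lambda>x. indicator T x *\<^sub>R ?g x)"
    by (rule borel_integrable_compact[OF T_comp]) (intro continuous_intros)
  then have int: "integrable (lborel \<Otimes>\<^sub>M lborel) (\<lambda>x. indicator T x *\<^sub>R ?g x)"
    by (simp add: lborel_prod)
  have "integral\<^sup>L lborel (\<lambda>x. indicator T x *\<^sub>R ?g x) =
      (\<integral>s. (\<integral>t. indicator T (s, t) *\<^sub>R ?g (s, t) \<partial>lborel) \<partial>lborel)"
    using lborel_pair.integral_fst'[OF int] by (simp add: lborel_prod)
  also have "\<dots> = (\<integral>s. indicator {0..1} s *\<^sub>R ((1 - s) * (a + b * s) + c * (1 - s)\<^sup>2 / 2) \<partial>lborel)"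
  proof (intro Bochner_Integration.integral_cong refl)
    fix s :: real
    show "(\<integral>t. indicator T (s, t) *\<^sub>R ?g (s, t) \<partial>lborel)
        = indicator {0..1} s *\<^sub>R ((1 - s) * (a + b * s) + c * (1 - s)\<^sup>2 / 2)"
    proof (cases "s \<in> {0..1}")
      case True
      have "(\<integral>t. indicator T (s, t) *\<^sub>R ?g (s, t) \<partial>lborel) =
          (\<integral>t. indicator {0..1 - s} t *\<^sub>R (a + b * s + c * t) \<partial>lborel)"
        using True by (intro Bochner_Integration.integral_cong) (auto simp: T indicator_def)
      also have "\<dots> = (\<lambda>t. (a + b * s) * t + c * t\<^sup>2 / 2) (1 - s) - (\<lambda>t. (a + b * s) * t + c * t\<^sup>2 / 2) 0"
        using True
        by (intro integral_FTC_Icc) (auto intro!: derivative_eq_intros continuous_intros simp: has_real_derivative_iff_has_vector_derivative[symmetric])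
      also have "\<dots> = (1 - s) * (a + b * s) + c * (1 - s)\<^sup>2 / 2" by simp
      finally show ?thesis using True by simp
    next
      case False
      then have "indicator T (s, t) = (0::real)" for t by (auto simp: T indicator_def)
      then show ?thesis using False by simp
    qed
  qed
  also have "\<dots> = (\<lambda>s. (a + c / 2) * s + (b - a - c) * s\<^sup>2 / 2 + (c / 2 - b) * s ^ 3 / 3) 1
      - (\<lambda>s. (a + c / 2) * s + (b - a - c) * s\<^sup>2 / 2 + (c / 2 - b) * s ^ 3 / 3) 0"
    by (intro integral_FTC_Icc)
      (auto intro!: derivative_eq_intros continuous_intros
        simp: has_real_derivative_iff_has_vector_derivative[symmetric] field_simps power2_eq_square)
  also have "\<dots> = (3 * a + b + c) / 6" by (simp add: field_simps)
  finally have "integral\<^sup>L lborel (\<lambda>x. indicator T x *\<^sub>R ?g x) = (3 * a + b + c) / 6" .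
  then have "((\<lambda>x. indicator T x *\<^sub>R ?g x) has_integral (3 * a + b + c) / 6) UNIV"
    using has_integral_integral_lborel[OF \<open>integrable lborel (\<lambda>x. indicator T x *\<^sub>R ?g x)\<close>] by metis
  then have "(?g has_integral (3 * a + b + c) / 6) T"
    by (subst (asm) indicator_scaleR_eq_if) (simp add: has_integral_restrict_UNIV)
  then show ?thesis
    by (rule has_integral_eq[rotated]) (use f in auto)
qed

definition param_comb :: "real \<Rightarrow> real \<Rightarrow> 3 \<Rightarrow> real" where
  "param_comb s t = (\<lambda>j. if j = 1 then 1 - s - t else if j = 2 then s else t)"

lemma param_comb:
  assumes "0 \<le> s" "0 \<le> t" "s + t \<le> 1"
  shows "bary (param_comb s t)" "comb (param_comb s t) p = p 1 + s *\<^sub>R (p 2 - p 1) + t *\<^sub>R (p 3 - p 1)"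
  using assms by (simp_all add: bary_def comb_def sum_3 forall_3 param_comb_def algebra_simps)

lemma has_integral_param_comb:
  fixes f :: "real^3 \<Rightarrow> real" and g :: "3 \<Rightarrow> real"
  assumes "\<And>c. bary c \<Longrightarrow> f (comb c p) = comb c g"
  shows "((\<lambda>(s, t). f (p 1 + s *\<^sub>R (p 2 - p 1) + t *\<^sub>R (p 3 - p 1)))
    has_integral (\<Sum>j\<in>UNIV. g j) / 6) {(s, t). 0 \<le> s \<and> 0 \<le> t \<and> s + t \<le> (1::real)}"
proof -
  have "((\<lambda>(s, t). f (p 1 + s *\<^sub>R (p 2 - p 1) + t *\<^sub>R (p 3 - p 1))) has_integral
      (3 * g 1 + (g 2 - g 1) + (g 3 - g 1)) / 6) {(s, t). 0 \<le> s \<and> 0 \<le> t \<and> s + t \<le> (1::real)}"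
  proof (rule integral_std_triangle[OF _ refl])
    fix s t :: real assume "(s, t) \<in> {(s, t). 0 \<le> s \<and> 0 \<le> t \<and> s + t \<le> 1}"
    then have st: "0 \<le> s" "0 \<le> t" "s + t \<le> 1" by auto
    have "f (p 1 + s *\<^sub>R (p 2 - p 1) + t *\<^sub>R (p 3 - p 1)) = comb (param_comb s t) g"
      using assms[OF param_comb(1)[OF st]] param_comb(2)[OF st, of p] by simp
    then show "(case (s, t) of (s, t) \<Rightarrow> f (p 1 + s *\<^sub>R (p 2 - p 1) + t *\<^sub>R (p 3 - p 1)))
        = g 1 + (g 2 - g 1) * s + (g 3 - g 1) * t"
      using param_comb(2)[OF st, of g] by (simp add: mult.commute)
  qed
  then show ?thesis by (simp add: sum_3 add.assoc)
qed

lemma tri_integral_comb: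
  assumes "\<And>c. bary c \<Longrightarrow> f (comb c p) = comb c g"
  shows "tri_integral p f = norm (Jvec p) / 6 * (\<Sum>j\<in>UNIV. g j)"
  unfolding tri_integral_def using integral_unique[OF has_integral_param_comb[of f p g, OF assms]] by simp

lemma tri_integral_cong:
  assumes "\<And>x. x \<in> tri p \<Longrightarrow> f x = g x"
  shows "tri_integral p f = tri_integral p g"
proof -
  have "f (p 1 + s *\<^sub>R (p 2 - p 1) + t *\<^sub>R (p 3 - p 1)) = g (p 1 + s *\<^sub>R (p 2 - p 1) + t *\<^sub>R (p 3 - p 1))"
    if "0 \<le> s" "0 \<le> t" "s + t \<le> 1" for s t
    using assms comb_in_tri[OF param_comb(1)[OF that], of p] param_comb(2)[OF that, of p] by simp
  then show ?thesis unfolding tri_integral_def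
    by (intro arg_cong2[where f = "(*)"] refl integral_cong) auto
qed

lemma tri_integral_nonneg:
  assumes "\<And>x. 0 \<le> f x" shows "0 \<le> tri_integral p f"
proof -
  let ?f = "\<lambda>(s, t). f (p 1 + s *\<^sub>R (p 2 - p 1) + t *\<^sub>R (p 3 - p 1))"
  let ?S = "{(s, t). 0 \<le> s \<and> 0 \<le> t \<and> s + t \<le> (1::real)}"
  have "0 \<le> integral ?S ?f"
  proof (cases "?f integrable_on ?S")
    case True
    then show ?thesis using assms by (intro integral_nonneg) auto
  next
    case False
    then show ?thesis by (simp add: not_integrable_integral)
  qed
  then show ?thesis unfolding tri_integral_def by simp
qed

lemma l2_inner_constant:
  assumes nd: "\<And>k. Jvec (N k) \<noteq> 0" and "\<xi> \<in> S_h N"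
  shows "l2_inner N (\<lambda>k _. w k) (\<lambda>_. \<xi>) =
    (\<Sum>k\<in>UNIV. norm (Jvec (N k)) / 6 * (\<Sum>j\<in>UNIV. w k \<bullet> \<xi> (N k j)))"
  unfolding l2_inner_def surf_integral_def
  using assms(2) unfolding S_h_iff[OF nd]
  by (intro sum.cong refl tri_integral_comb) (simp add: comb_def inner_sum_right)

text \<open>Testing against the nodal basis shows that the nodal value of the projection at a vertex is the
  area-weighted average of the values on the adjacent triangles.\<close>

lemma pi_h_spec:
  assumes N: "closed_polyhedral_surface N"
  shows "pi_h N w \<in> S_h N"
    "\<xi> \<in> S_h N \<Longrightarrow> lumped_inner N (pi_h N w) \<xi> = l2_inner N (\<lambda>k _. w k) (\<lambda>_. \<xi>)"
proof -
  note nd = closed_surfaceD(1)[OF N]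
  define I where "I p = {q. N (fst q) (snd q) = p}" for p
  define W where "W p = (\<Sum>q\<in>I p. norm (Jvec (N (fst q))))" for p
  define g where "g p = (1 / W p) *\<^sub>R (\<Sum>q\<in>I p. norm (Jvec (N (fst q))) *\<^sub>R w (fst q))" for p
  obtain v where v: "v \<in> S_h N" "\<And>k j. v (N k j) = g (N k j)"
    using ex_interp[OF N, of g] by blast
  define V where "V = range (\<lambda>q. N (fst q) (snd q))"
  have sum_V: "(\<Sum>k\<in>UNIV. \<Sum>j\<in>UNIV. h k (N k j)) = (\<Sum>p\<in>V. \<Sum>q\<in>I p. h (fst q) p)"
    for h :: "'a \<Rightarrow> real^3 \<Rightarrow> real"
  proof -
    have "(\<Sum>k\<in>UNIV. \<Sum>j\<in>UNIV. h k (N k j)) = (\<Sum>q\<in>UNIV. h (fst q) (N (fst q) (snd q)))"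
      by (simp add: sum.cartesian_product case_prod_beta)
    also have "\<dots> = (\<Sum>p\<in>V. \<Sum>q\<in>{q \<in> UNIV. N (fst q) (snd q) = p}. h (fst q) (N (fst q) (snd q)))"
      unfolding V_def by (rule sum.image_gen) simp
    also have "\<dots> = (\<Sum>p\<in>V. \<Sum>q\<in>I p. h (fst q) p)"
      by (intro sum.cong) (auto simp: I_def)
    finally show ?thesis .
  qed
  have Wpos: "W p > 0" if "p \<in> V" for p
  proof -
    have "I p \<noteq> {}" using that by (auto simp: V_def I_def)
    then show ?thesis unfolding W_def using nd by (intro sum_pos) auto
  qed
  have "lumped_inner N v \<xi> = l2_inner N (\<lambda>k _. w k) (\<lambda>_. \<xi>)" if "\<xi> \<in> S_h N" for \<xi>
  proof -
    have "lumped_inner N v \<xi> = (\<Sum>k\<in>UNIV. \<Sum>j\<in>UNIV. norm (Jvec (N k)) / 6 * (g (N k j) \<bullet> \<xi> (N k j)))"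
      by (simp add: lumped_inner_def tri_area_def v(2) sum_distrib_left)
    also have "\<dots> = (\<Sum>p\<in>V. \<Sum>q\<in>I p. norm (Jvec (N (fst q))) / 6 * (g p \<bullet> \<xi> p))"
      by (rule sum_V)
    also have "\<dots> = (\<Sum>p\<in>V. W p * (g p \<bullet> \<xi> p) / 6)"
      by (simp add: W_def sum_distrib_right sum_divide_distrib)
    also have "\<dots> = (\<Sum>p\<in>V. (\<Sum>q\<in>I p. norm (Jvec (N (fst q))) / 6 * (w (fst q) \<bullet> \<xi> p)))"
    proof (intro sum.cong refl)
      fix p assume "p \<in> V"
      then have "W p * (g p \<bullet> \<xi> p) = (\<Sum>q\<in>I p. norm (Jvec (N (fst q))) *\<^sub>R w (fst q)) \<bullet> \<xi> p"
        using Wpos[of p] by (simp add: g_def)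
      then show "W p * (g p \<bullet> \<xi> p) / 6 = (\<Sum>q\<in>I p. norm (Jvec (N (fst q))) / 6 * (w (fst q) \<bullet> \<xi> p))"
        by (simp add: inner_sum_left sum_divide_distrib)
    qed
    also have "\<dots> = (\<Sum>k\<in>UNIV. \<Sum>j\<in>UNIV. norm (Jvec (N k)) / 6 * (w k \<bullet> \<xi> (N k j)))"
      by (rule sum_V[symmetric])
    also have "\<dots> = l2_inner N (\<lambda>k _. w k) (\<lambda>_. \<xi>)"
      by (simp add: l2_inner_constant[OF nd that] sum_distrib_left)
    finally show ?thesis .
  qed
  then have "\<exists>v. v \<in> S_h N \<and> (\<forall>\<xi>\<in>S_h N. lumped_inner N v \<xi> = l2_inner N (\<lambda>k _. w k) (\<lambda>_. \<xi>))"
    using v(1) by blast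
  from someI_ex[OF this] show "pi_h N w \<in> S_h N"
    "\<xi> \<in> S_h N \<Longrightarrow> lumped_inner N (pi_h N w) \<xi> = l2_inner N (\<lambda>k _. w k) (\<lambda>_. \<xi>)"
    unfolding pi_h_def by blast+
qed

section \<open>Volume change along a linear path\<close>

definition edge_flux :: "real^3 \<Rightarrow> real^3 \<Rightarrow> real^3 \<Rightarrow> real^3 \<Rightarrow> real" where
  "edge_flux a b a' b' = ((b - a) + (b' - a')) \<bullet> (cross3 a a' + cross3 (a + b) (a' + b') + cross3 b b')"

lemma edge_flux_antisym: "edge_flux a b a' b' = - edge_flux a' b' a b"
proof -
  have "cross3 a a' + cross3 (a + b) (a' + b') + cross3 b b'
      = - (cross3 a' a + cross3 (a' + b') (a + b) + cross3 b' b)"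
    using cross_skew[of a a'] cross_skew[of "a + b" "a' + b'"] cross_skew[of b b'] by simp
  then show ?thesis unfolding edge_flux_def by (simp only: inner_minus_right add.commute)
qed

lemma tdet_diff:
  "6 * (tdet b - tdet a) =
     (\<Sum>j\<in>UNIV. b j - a j) \<bullet> (Jvec a + Jvec (\<lambda>j. a j + b j) + Jvec b)
     - (\<Sum>j\<in>UNIV. edge_flux (a j) (b j) (a (j + 1)) (b (j + 1)))"
proof -
  have i: "(1::3) + 1 = 2" "(2::3) + 1 = 3" "(3::3) + 1 = 1" by simp_all
  show ?thesis
    unfolding sum_3 i edge_flux_def tdet_def Jvec_def
    unfolding cross3_def inner_vec_def sum_3 vector_3 inner_real_def
      vector_add_component vector_minus_component
    by algebra
qed

lemma sum_edges_antisym: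
  fixes E :: "real^3 \<Rightarrow> real^3 \<Rightarrow> real"
  assumes M: "closed_polyhedral_surface M" and E: "\<And>a b. E a b = - E b a"
  shows "(\<Sum>k\<in>UNIV. \<Sum>j\<in>UNIV. E (M k j) (M k (j + 1))) = 0"
proof -
  have "\<exists>!(l, i). M l i = M k (j + 1) \<and> M l (i + 1) = M k j" for k j
    using M unfolding closed_polyhedral_surface_def by blast
  then have ex1: "\<exists>!q. M (fst q) (snd q) = M k (j + 1) \<and> M (fst q) (snd q + 1) = M k j" for k j
    by (simp add: case_prod_unfold)
  define f where "f = (\<lambda>(k, j). THE q. M (fst q) (snd q) = M k (j + 1) \<and> M (fst q) (snd q + 1) = M k j)"
  have f: "M (fst (f q)) (snd (f q)) = M (fst q) (snd q + 1)"
    "M (fst (f q)) (snd (f q) + 1) = M (fst q) (snd q)" for q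
    using theI'[OF ex1[of "fst q" "snd q"]] by (simp_all add: f_def case_prod_beta)
  have ff: "f (f q) = q" for q
    using ex1[of "fst (f q)" "snd (f q)"] f[of q] f[of "f q"] by metis
  define h where "h q = E (M (fst q) (snd q)) (M (fst q) (snd q + 1))" for q
  have hf: "h (f q) = - h q" for q unfolding h_def f by (rule E)
  have "(\<Sum>q\<in>UNIV. h q) = (\<Sum>q\<in>UNIV. h (f q))"
    by (rule sum.reindex_bij_witness[of _ f f]) (simp_all add: ff)
  also have "\<dots> = (\<Sum>q\<in>UNIV. - h q)"
    by (simp add: hf)
  finally have "(\<Sum>q\<in>UNIV. h q) = 0" by (simp add: sum_negf)
  then show ?thesis
    by (simp add: h_def sum.cartesian_product case_prod_beta)
qed

lemma Jvec_scale: "Jvec (\<lambda>j. c *\<^sub>R p j) = c\<^sup>2 *\<^sub>R Jvec p"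
  unfolding Jvec_def scaleR_right_diff_distrib[symmetric] cross_mult_left cross_mult_right
  by (simp add: power2_eq_square)

text \<open>Simpson's rule is exact here: the volume is a cubic polynomial of the time along the linear
  path from \<open>X0\<close> to \<open>X1\<close>.\<close>

lemma tdet_sum_diff:
  assumes M: "closed_polyhedral_surface M"
  shows "(\<Sum>k\<in>UNIV. tdet (image_mesh X1 M k)) - (\<Sum>k\<in>UNIV. tdet (image_mesh X0 M k)) =
    (\<Sum>k\<in>UNIV. (1 / 6) *\<^sub>R (Jvec (image_mesh X0 M k) + 4 *\<^sub>R Jvec (image_mesh (mid_param X0 X1) M k)
        + Jvec (image_mesh X1 M k)) \<bullet> (\<Sum>j\<in>UNIV. X1 (M k j) - X0 (M k j)))"
proof -
  let ?J = "\<lambda>k. Jvec (image_mesh X0 M k) + 4 *\<^sub>R Jvec (image_mesh (mid_param X0 X1) M k)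
      + Jvec (image_mesh X1 M k)"
  let ?F = "\<lambda>a b. edge_flux (X0 a) (X1 a) (X0 b) (X1 b)"
  have "4 *\<^sub>R Jvec (image_mesh (mid_param X0 X1) M k) = Jvec (\<lambda>j. X0 (M k j) + X1 (M k j))" for k
    unfolding image_mesh_def mid_param_def Jvec_scale by (simp add: power2_eq_square)
  then have "6 * (tdet (image_mesh X1 M k) - tdet (image_mesh X0 M k)) =
      (\<Sum>j\<in>UNIV. X1 (M k j) - X0 (M k j)) \<bullet> ?J k - (\<Sum>j\<in>UNIV. ?F (M k j) (M k (j + 1)))" for k
    using tdet_diff[of "image_mesh X1 M k" "image_mesh X0 M k"] by (simp add: image_mesh_def)
  then have "(\<Sum>k\<in>UNIV. 6 * (tdet (image_mesh X1 M k) - tdet (image_mesh X0 M k))) =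
      (\<Sum>k\<in>UNIV. (\<Sum>j\<in>UNIV. X1 (M k j) - X0 (M k j)) \<bullet> ?J k)
      - (\<Sum>k\<in>UNIV. \<Sum>j\<in>UNIV. ?F (M k j) (M k (j + 1)))"
    by (simp add: sum_subtractf)
  also have "(\<Sum>k\<in>UNIV. \<Sum>j\<in>UNIV. ?F (M k j) (M k (j + 1))) = 0"
    by (rule sum_edges_antisym[OF M edge_flux_antisym])
  finally show ?thesis
    by (simp add: sum_distrib_left[symmetric] sum_divide_distrib[symmetric] sum_subtractf inner_commute)
qed

section \<open>One step of the scheme\<close>

lemma tri_grad_zero:
  assumes J: "Jvec p \<noteq> 0" and x: "x \<in> tri p" and f: "\<And>y. y \<in> tri p \<Longrightarrow> f y = 0"
  shows "tri_grad p f x = 0"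
  unfolding tri_grad_def
proof (rule the_equality)
  have "(f has_derivative (\<lambda>h. 0)) (at x within tri p)"
    by (rule has_derivative_transform[OF x f has_derivative_const]) auto
  moreover have "(*v) (0 :: real^3^3) = (\<lambda>h. 0)" by (simp add: fun_eq_iff)
  ultimately show "(f has_derivative (*v) 0) (at x within tri p) \<and> 0 *v Jvec p = 0"
    by simp
next
  fix A :: "real^3^3"
  assume A: "(f has_derivative (*v) A) (at x within tri p) \<and> A *v Jvec p = 0"
  have dir: "A *v (w - x) = 0" if "w \<in> tri p" for w
  proof -
    define g where "g e = x + e *\<^sub>R (w - x)" for e :: real
    have sub: "g ` {0..1} \<subseteq> tri p"
    proof
      fix y assume "y \<in> g ` {0..1}"
      then obtain e where e: "0 \<le> e" "e \<le> 1" "y = (1 - e) *\<^sub>R x + e *\<^sub>R w"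
        by (auto simp: g_def algebra_simps)
      have "convex (tri p)" by (simp add: tri_def)
      then show "y \<in> tri p" using e x that by (auto intro!: convexD)
    qed
    have "(g has_derivative (\<lambda>h. h *\<^sub>R (w - x))) (at 0 within {0..1})"
      unfolding g_def by (auto intro!: derivative_eq_intros)
    moreover have "(f has_derivative (*v) A) (at (g 0) within g ` {0..1})"
      using A sub by (auto simp: g_def intro: has_derivative_subset)
    ultimately have "((\<lambda>e. f (g e)) has_derivative (\<lambda>h. A *v (h *\<^sub>R (w - x)))) (at 0 within {0..1})"
      by (rule has_derivative_in_compose)
    then have "((\<lambda>e. f (g e)) has_vector_derivative A *v (w - x)) (at 0 within {0..1})"
      by (simp add: has_vector_derivative_def matrix_vector_mult_scaleR)
    moreover have "((\<lambda>e. f (g e)) has_vector_derivative 0) (at 0 within {0..1})"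
    proof (rule has_vector_derivative_transform[OF _ _ has_vector_derivative_const[of 0]])
      show "f (g e) = 0" if "e \<in> {0..1}" for e
        using sub f that by blast
    qed simp
    moreover have "at (0::real) within {0..1} \<noteq> bot"
      by (simp add: trivial_limit_within islimpt_Icc)
    ultimately show ?thesis using vector_derivative_unique_within by blast
  qed
  have diff: "A *v (p i - p 1) = 0" for i
    using dir[OF vertex_in_tri, of i] dir[OF vertex_in_tri, of 1]
    by (simp add: matrix_vector_mult_diff_distrib)
  have "A $ i = 0" for i
  proof -
    have orth: "A $ i \<bullet> v = 0" if "A *v v = 0" for v
      using that by (metis matrix_vector_mul_component zero_index)
    have "cross3 (A $ i) (Jvec p) = 0"
      unfolding Jvec_def Lagrange using orth[OF diff] by simp
    moreover have "A $ i \<bullet> Jvec p = 0" using orth A by blast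
    ultimately show ?thesis using norm_and_cross_eq_0[of "A $ i" "Jvec p"] J by blast
  qed
  then show "A = 0" by (simp add: vec_eq_iff)
qed

lemma Pmat_mult_self: "Pmat \<nu> q *v q = 0"
proof -
  have "(\<chi> i j. q $ i * \<nu> $ j) *v q = (\<nu> \<bullet> q) *\<^sub>R q"
    by (simp add: vec_eq_iff matrix_vector_mult_def inner_vec_def sum_distrib_left mult.assoc
        mult.commute mult.left_commute)
  moreover have "((\<nu> \<bullet> q) *\<^sub>R mat 1) *v q = (\<nu> \<bullet> q) *\<^sub>R q"
    by (simp add: scaleR_matrix_vector_assoc[symmetric])
  ultimately show ?thesis
    by (simp add: Pmat_def matrix_vector_mult_diff_rdistrib)
qed

lemma comb_diff: "comb c (\<lambda>j. f j - g j) = comb c f - comb c g"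
  by (simp add: comb_def scaleR_right_diff_distrib sum_subtractf)

lemma comb_scaleR: "comb c (\<lambda>j. a *\<^sub>R f j) = a *\<^sub>R comb c f"
  by (simp add: comb_def scaleR_sum_right mult.commute)

lemma comb_const: "bary c \<Longrightarrow> comb c (\<lambda>_. a) = a"
  by (simp add: comb_def bary_def scaleR_sum_left[symmetric])

lemma S_h_constant:
  assumes "\<And>k. Jvec (N k) \<noteq> 0" "f \<in> S_h N" "\<And>k j. f (N k j) = a" "x \<in> tri (N k)"
  shows "f x = a"
  using assms unfolding S_h_iff[OF assms(1)] tri_eq_comb by (auto simp: comb_const)

lemma parameterizesD:
  assumes "parameterizes M X"
  shows "X \<in> S_h M" "inj_on X (surf M)" "closed_polyhedral_surface (image_mesh X M)"
    "outward_oriented (image_mesh X M)"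
  using assms by (auto simp: parameterizes_def)

lemma vertex_in_surf: "M k j \<in> surf M"
  using vertex_in_tri[of "M k" j] by (auto simp: surf_def)

lemma lift_apply:
  assumes "inj_on Y (surf M)" "x \<in> surf M"
  shows "lift M Y F (Y x) = F x"
  using assms by (simp add: lift_def)

lemma lift_S_h:
  assumes M: "closed_polyhedral_surface M" and Y: "parameterizes M Y" and F: "F \<in> S_h M"
  shows "lift M Y F \<in> S_h (image_mesh Y M)"
proof -
  note ndM = closed_surfaceD(1)[OF M]
  note ndG = closed_surfaceD(1)[OF parameterizesD(3)[OF Y]]
  have "lift M Y F (comb c (image_mesh Y M k)) = comb c (\<lambda>j. lift M Y F (image_mesh Y M k j))"
    if c: "bary c" for k c
  proof -
    have "comb c (image_mesh Y M k) = Y (comb c (M k))"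
      using parameterizesD(1)[OF Y] c unfolding S_h_iff[OF ndM] by (simp add: image_mesh_def)
    moreover have "comb c (M k) \<in> surf M" using comb_in_tri[OF c] by (auto simp: surf_def)
    ultimately have "lift M Y F (comb c (image_mesh Y M k)) = F (comb c (M k))"
      using lift_apply[OF parameterizesD(2)[OF Y]] by simp
    also have "\<dots> = comb c (\<lambda>j. F (M k j))" using F c unfolding S_h_iff[OF ndM] by simp
    also have "\<dots> = comb c (\<lambda>j. lift M Y F (image_mesh Y M k j))"
      using lift_apply[OF parameterizesD(2)[OF Y] vertex_in_surf, of F] by (simp add: image_mesh_def)
    finally show ?thesis .
  qed
  then show ?thesis by (simp add: S_h_iff[OF ndG])
qed

lemma l2_inner_grad_zero:
  assumes M: "closed_polyhedral_surface M" and Z: "Z \<in> S_h M" "\<And>k j. Z (M k j) = 0"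
  shows "l2_inner M F (surf_grad M Z) = 0"
proof -
  note nd = closed_surfaceD(1)[OF M]
  have "tri_integral (M k) (\<lambda>x. F k x \<bullet> surf_grad M Z k x) = tri_integral (M k) (\<lambda>_. 0)" for k
    using tri_grad_zero[OF nd _ S_h_constant[OF nd Z]]
    by (intro tri_integral_cong) (simp add: surf_grad_def)
  moreover have "tri_integral p (\<lambda>_. 0) = 0" for p
    by (simp add: tri_integral_def case_prod_unfold)
  ultimately show ?thesis by (simp add: l2_inner_def surf_integral_def)
qed

lemma l2_inner_mean_free_one:
  assumes N: "closed_polyhedral_surface N" and H: "H \<in> S_h N"
    and R: "R \<in> S_h N" "\<And>k j. R (N k j) = 1"
  shows "l2_inner N (\<lambda>_ x. H x - surf_mean N H) (\<lambda>_. R) = 0"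
proof -
  note nd = closed_surfaceD(1)[OF N]
  have pos: "surf_area N > 0"
    unfolding surf_area_def tri_area_def using nd by (intro sum_pos) auto
  have "l2_inner N (\<lambda>_ x. H x - surf_mean N H) (\<lambda>_. R)
      = (\<Sum>k\<in>UNIV. tri_integral (N k) (\<lambda>x. H x - surf_mean N H))"
    unfolding l2_inner_def surf_integral_def
    using S_h_constant[OF nd R] by (intro sum.cong refl tri_integral_cong) simp
  also have "\<dots> = (\<Sum>k\<in>UNIV. norm (Jvec (N k)) / 6 * (\<Sum>j\<in>UNIV. H (N k j) - surf_mean N H))"
    using H unfolding S_h_iff[OF nd]
    by (intro sum.cong refl tri_integral_comb) (simp add: comb_diff comb_const)
  also have "\<dots> = (\<Sum>k\<in>UNIV. norm (Jvec (N k)) / 6 * (\<Sum>j\<in>UNIV. H (N k j))) - surf_mean N H * surf_area N"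
    by (simp add: sum_subtractf surf_area_def tri_area_def right_diff_distrib sum_distrib_left mult.commute)
  also have "(\<Sum>k\<in>UNIV. norm (Jvec (N k)) / 6 * (\<Sum>j\<in>UNIV. H (N k j))) = surf_integral N (\<lambda>_. H)"
    unfolding surf_integral_def using H unfolding S_h_iff[OF nd]
    by (intro sum.cong refl tri_integral_comb[symmetric]) simp
  also have "surf_integral N (\<lambda>_. H) = surf_mean N H * surf_area N"
    using pos by (simp add: surf_mean_def)
  finally show ?thesis by simp
qed

lemma scheme_step_volume:
  assumes M: "closed_polyhedral_surface M" and Y: "parameterizes M Y"
    and X: "parameterizes M X0" "parameterizes M X1" and \<tau>: "\<tau> \<noteq> 0"
    and wd: "step_well_defined M Y X0 X1"
    and step: "scheme_step M \<alpha> \<tau> Y X0 X1 u1 H lam"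
  shows "enclosed_volume (image_mesh X1 M) = enclosed_volume (image_mesh X0 M)"
proof -
  define G where "G = image_mesh Y M"
  define u0 where "u0 = lift M Y X0"
  define n where "n = averaged_normal M Y X0 X1"
  define q where "q = pi_h G n"
  define w where "w = (\<lambda>x. (1 / \<tau>) *\<^sub>R (u1 x - u0 x))"
  define H0 where "H0 = (\<lambda>x. H x - surf_mean G H)"
  define Z where "Z = interp M ((\<lambda>x. Pmat (weighted_normal G x) (q x) *v q x) \<circ> Y)"
  define R where "R = interp G (\<lambda>x. (q x \<bullet> q x) / (norm (q x))\<^sup>2)"
  have G: "closed_polyhedral_surface G" using parameterizesD(3)[OF Y] by (simp add: G_def)
  note ndG = closed_surfaceD(1)[OF G]
  have q: "q \<in> S_h G" unfolding q_def by (rule pi_h_spec(1)[OF G])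
  have u1: "u1 \<in> S_h G" and H: "H \<in> S_h G" and X1: "\<And>x. x \<in> surf M \<Longrightarrow> X1 x = u1 (Y x)"
    and eq: "\<And>\<xi>. \<xi> \<in> S_h G \<Longrightarrow> lumped_inner G w \<xi>
      + \<alpha> * l2_inner M (surf_grad M (mid_param X0 X1))
          (surf_grad M (interp M ((\<lambda>x. Pmat (weighted_normal G x) (q x) *v \<xi> x) \<circ> Y)))
      + lam * l2_inner G (\<lambda>_. H0) (\<lambda>_. interp G (\<lambda>x. (\<xi> x \<bullet> q x) / (norm (q x))\<^sup>2)) = 0"
    using step unfolding scheme_step_def Let_def G_def u0_def n_def q_def w_def H0_def by blast+
  have u0: "u0 \<in> S_h G"
    unfolding u0_def G_def by (rule lift_S_h[OF M Y parameterizesD(1)[OF X(1)]])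
  have w: "w \<in> S_h G"
    using u0 u1 unfolding S_h_iff[OF ndG] w_def by (simp add: comb_diff comb_scaleR)
  have wv: "w (G k j) = (1 / \<tau>) *\<^sub>R (X1 (M k j) - X0 (M k j))" for k j
    using lift_apply[OF parameterizesD(2)[OF Y] vertex_in_surf[of M k j], of X0] X1[OF vertex_in_surf[of M k j]]
    by (simp add: w_def u0_def G_def image_mesh_def)
  have "Z (M k j) = 0" for k j
    unfolding Z_def interp_spec(2)[OF M] by (simp add: Pmat_mult_self)
  then have Z: "l2_inner M F (surf_grad M Z) = 0" for F
    using interp_spec(1)[OF M] by (intro l2_inner_grad_zero[OF M]) (auto simp: Z_def)
  have "q (G k j) \<noteq> 0" for k j
    using wd unfolding step_well_defined_def Let_def q_def n_def G_def by blast
  then have "R (G k j) = 1" for k j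
    unfolding R_def interp_spec(2)[OF G] by (simp add: power2_norm_eq_inner)
  then have R: "l2_inner G (\<lambda>_. H0) (\<lambda>_. R) = 0"
    unfolding H0_def using interp_spec(1)[OF G]
    by (intro l2_inner_mean_free_one[OF G H]) (auto simp: R_def)
  have "0 = lumped_inner G w q"
    using eq[OF q] Z R by (simp add: Z_def R_def)
  also have "\<dots> = lumped_inner G q w" by (simp add: lumped_inner_def inner_commute)
  also have "\<dots> = l2_inner G (\<lambda>k _. n k) (\<lambda>_. w)"
    unfolding q_def by (rule pi_h_spec(2)[OF G w])
  also have "\<dots> = (\<Sum>k\<in>UNIV. norm (Jvec (G k)) / 6 * (\<Sum>j\<in>UNIV. n k \<bullet> w (G k j)))"
    by (rule l2_inner_constant[OF ndG w])
  also have "\<dots> = (\<Sum>k\<in>UNIV. 1 / (6 * \<tau>) * ((1 / 6) *\<^sub>R (Jvec (image_mesh X0 M k)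
      + 4 *\<^sub>R Jvec (image_mesh (mid_param X0 X1) M k) + Jvec (image_mesh X1 M k))
      \<bullet> (\<Sum>j\<in>UNIV. X1 (M k j) - X0 (M k j))))"
  proof (intro sum.cong refl)
    fix k
    let ?S = "\<Sum>j\<in>UNIV. X1 (M k j) - X0 (M k j)"
    let ?J = "Jvec (image_mesh X0 M k) + 4 *\<^sub>R Jvec (image_mesh (mid_param X0 X1) M k)
      + Jvec (image_mesh X1 M k)"
    have "(\<Sum>j\<in>UNIV. n k \<bullet> w (G k j)) = (1 / \<tau>) * (n k \<bullet> ?S)"
      by (simp only: wv inner_scaleR_right inner_sum_right sum_distrib_left)
    moreover have "n k \<bullet> ?S = (1 / (6 * norm (Jvec (G k)))) * (?J \<bullet> ?S)"
      by (simp only: n_def averaged_normal_def G_def inner_scaleR_left)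
    ultimately show "norm (Jvec (G k)) / 6 * (\<Sum>j\<in>UNIV. n k \<bullet> w (G k j))
        = 1 / (6 * \<tau>) * ((1 / 6) *\<^sub>R ?J \<bullet> ?S)"
      unfolding inner_scaleR_left using ndG[of k] \<tau> by (simp add: field_simps)
  qed
  also have "\<dots> = 1 / (6 * \<tau>) * ((\<Sum>k\<in>UNIV. tdet (image_mesh X1 M k)) - (\<Sum>k\<in>UNIV. tdet (image_mesh X0 M k)))"
    unfolding tdet_sum_diff[OF M] by (simp only: sum_distrib_left)
  finally have "(\<Sum>k\<in>UNIV. tdet (image_mesh X1 M k)) = (\<Sum>k\<in>UNIV. tdet (image_mesh X0 M k))"
    using \<tau> by simp
  then show ?thesis
    using enclosed_volume_eq parameterizesD(3,4)[OF X(1)] parameterizesD(3,4)[OF X(2)] by metis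
qed

lemma scheme_step_area:
  assumes "scheme_step M \<alpha> \<tau> Y X0 X1 u1 H lam" "\<tau> > 0"
  shows "surf_area (image_mesh X1 M) \<le> surf_area (image_mesh X0 M)"
proof -
  let ?G = "image_mesh Y M"
  let ?H0 = "\<lambda>x. H x - surf_mean ?G H"
  have "(surf_area (image_mesh X1 M) - surf_area (image_mesh X0 M)) / \<tau>
      + l2_inner ?G (\<lambda>_. ?H0) (\<lambda>_. ?H0) = 0"
    using assms(1) unfolding scheme_step_def Let_def by blast
  moreover have "0 \<le> l2_inner ?G (\<lambda>_. ?H0) (\<lambda>_. ?H0)"
    unfolding l2_inner_def surf_integral_def by (intro sum_nonneg tri_integral_nonneg) simp
  ultimately have "(surf_area (image_mesh X1 M) - surf_area (image_mesh X0 M)) / \<tau> \<le> 0"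
    by linarith
  then show ?thesis using assms(2) by (simp add: divide_le_0_iff)
qed

theorem theorem3p2:
  fixes M :: "'k::finite mesh"
    and \<alpha> Tend :: real and N :: nat and t :: "nat \<Rightarrow> real"
    and X u :: "nat \<Rightarrow> real^3 \<Rightarrow> real^3"
    and H :: "nat \<Rightarrow> real^3 \<Rightarrow> real"
    and lam :: "nat \<Rightarrow> real"
  assumes ref_surface: "closed_polyhedral_surface M"
    and alpha: "\<alpha> \<ge> 0"
    and partition: "t 0 = 0" "\<forall>m<N. t m < t (m + 1)" "t N = Tend"
    and surfaces: "\<forall>m\<le>N. parameterizes M (X m)"
    and mid_surfaces: "\<forall>m<N. parameterizes M (mid_param (X m) (X (m + 1)))"
    and extrap_surfaces: "\<forall>m. 1 \<le> m \<and> m < N \<longrightarrow> parameterizes M (extrap_param t X m)"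
    and well_defined: "\<forall>m<N. step_well_defined M (base_param t X m) (X m) (X (m + 1))"
    and scheme: "\<forall>m<N. scheme_step M \<alpha> (step_size t (m + 1)) (base_param t X m)
                   (X m) (X (m + 1)) (u (m + 1)) (H m) (lam (m + 1))"
  shows "(\<forall>m<N. enclosed_volume (image_mesh (X (m + 1)) M) = enclosed_volume (image_mesh (X m) M)
             \<and> enclosed_volume (image_mesh (X m) M) = enclosed_volume (image_mesh (X 0) M))
       \<and> (\<forall>m<N. surf_area (image_mesh (X (m + 1)) M) \<le> surf_area (image_mesh (X m) M))"
proof -
  have \<tau>: "step_size t (m + 1) > 0" if "m < N" for m
    using partition(2) that by (simp add: step_size_def)
  have base: "parameterizes M (base_param t X m)" if "m < N" for m
    using mid_surfaces extrap_surfaces that by (cases "m = 0") (auto simp: base_param_def)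
  have vol: "enclosed_volume (image_mesh (X (m + 1)) M) = enclosed_volume (image_mesh (X m) M)"
    if "m < N" for m
    using scheme_step_volume[OF ref_surface base[OF that]] surfaces well_defined scheme that \<tau>[OF that]
    by (metis Suc_eq_plus1 Suc_leI less_imp_le_nat less_irrefl)
  have "enclosed_volume (image_mesh (X m) M) = enclosed_volume (image_mesh (X 0) M)" if "m < N" for m
    using that by (induction m) (use vol in \<open>auto simp: Suc_lessD\<close>)
  moreover have "surf_area (image_mesh (X (m + 1)) M) \<le> surf_area (image_mesh (X m) M)" if "m < N" for m
    using scheme that \<tau>[OF that] scheme_step_area by blast
  ultimately show ?thesis using vol by blast
qed

end
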